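(* Fix an integer $m\geq 2$. Then, up to isomorphism, there are only finitely many non-complete coconnected non-geometric distance-regular graphs with smallest eigenvalue at least $-m$ and intersection number $c_2$ at least $2$.
   Context: All graphs are finite, undirected and simple. A connected graph $\Gamma$ with diameter $D$ is distance-regular if there are integers $b_i,c_i$ ($0\le i\le D$) such that for any vertices $x,y$ with $d(x,y)=i$, exactly $c_i$ neighbours of $y$ are at distance $i-1$ from $x$ and exactly $b_i$ neighbours of $y$ are at distance $i+1$ from $x$; it is then regular of valency $k=b_0$, and $a_i:=k-b_i-c_i$. The smallest eigenvalue $\theta_D$ is the smallest eigenvalue of the adjacency matrix. A clique is a set of pairwise adjacent vertices. A Delsarte clique in a distance-regular graph with valency $k$, diameter $D\ge 2$ and smallest eigenvalue $\theta_D$ is a clique with exactly $1+\frac{k}{-\theta_D}$ vertices. A non-complete distance-regular graph is geometric if there is a set $\mathcal C$ of Delsarte cliques such that every edge lies in exactly one member of $\mathcal C$. A graph is coconnected if its complement is connected. *)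

theory Defs
  imports Main "HOL-Library.Disjoint_Sets" Complex_Main
begin

definition simple_graph :: "'a set \<Rightarrow> ('a \<Rightarrow> 'a \<Rightarrow> bool) \<Rightarrow> bool" where
  "simple_graph V E \<longleftrightarrow> finite V \<and> (\<forall>x y. E x y \<longrightarrow> x \<in> V \<and> y \<in> V)
     \<and> (\<forall>x y. E x y \<longrightarrow> E y x) \<and> (\<forall>x. \<not> E x x)"

inductive walk :: "('a \<Rightarrow> 'a \<Rightarrow> bool) \<Rightarrow> nat \<Rightarrow> 'a \<Rightarrow> 'a \<Rightarrow> bool" for E where
  walk0: "walk E 0 x x"
| walkS: "walk E n x y \<Longrightarrow> E y z \<Longrightarrow> walk E (Suc n) x z"

definition connected_graph :: "'a set \<Rightarrow> ('a \<Rightarrow> 'a \<Rightarrow> bool) \<Rightarrow> bool" where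
  "connected_graph V E \<longleftrightarrow> V \<noteq> {} \<and> (\<forall>x\<in>V. \<forall>y\<in>V. \<exists>n. walk E n x y)"

definition gdist :: "('a \<Rightarrow> 'a \<Rightarrow> bool) \<Rightarrow> 'a \<Rightarrow> 'a \<Rightarrow> nat" where
  "gdist E x y = (LEAST n. walk E n x y)"

definition diameter :: "'a set \<Rightarrow> ('a \<Rightarrow> 'a \<Rightarrow> bool) \<Rightarrow> nat" where
  "diameter V E = Max {gdist E x y | x y. x \<in> V \<and> y \<in> V}"

definition complete_graph :: "'a set \<Rightarrow> ('a \<Rightarrow> 'a \<Rightarrow> bool) \<Rightarrow> bool" where
  "complete_graph V E \<longleftrightarrow> (\<forall>x\<in>V. \<forall>y\<in>V. x \<noteq> y \<longrightarrow> E x y)"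

definition complement_graph :: "'a set \<Rightarrow> ('a \<Rightarrow> 'a \<Rightarrow> bool) \<Rightarrow> ('a \<Rightarrow> 'a \<Rightarrow> bool)" where
  "complement_graph V E = (\<lambda>x y. x \<in> V \<and> y \<in> V \<and> x \<noteq> y \<and> \<not> E x y)"

definition coconnected :: "'a set \<Rightarrow> ('a \<Rightarrow> 'a \<Rightarrow> bool) \<Rightarrow> bool" where
  "coconnected V E \<longleftrightarrow> connected_graph V (complement_graph V E)"

definition distance_regular :: "'a set \<Rightarrow> ('a \<Rightarrow> 'a \<Rightarrow> bool) \<Rightarrow> bool" where
  "distance_regular V E \<longleftrightarrow> simple_graph V E \<and> connected_graph V E \<and>
     (\<exists>b c :: nat \<Rightarrow> nat. \<forall>x\<in>V. \<forall>y\<in>V.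
        card {z\<in>V. E y z \<and> gdist E x z + 1 = gdist E x y} = c (gdist E x y) \<and>
        card {z\<in>V. E y z \<and> gdist E x z = gdist E x y + 1} = b (gdist E x y))"

text \<open>The intersection number c_i (well defined for a distance-regular graph
  whenever 0 \<le> i \<le> D).\<close>
definition intersection_c :: "'a set \<Rightarrow> ('a \<Rightarrow> 'a \<Rightarrow> bool) \<Rightarrow> nat \<Rightarrow> nat" where
  "intersection_c V E i = (THE c. \<forall>x\<in>V. \<forall>y\<in>V. gdist E x y = i \<longrightarrow>
       card {z\<in>V. E y z \<and> gdist E x z + 1 = i} = c)"

definition valency :: "'a set \<Rightarrow> ('a \<Rightarrow> 'a \<Rightarrow> bool) \<Rightarrow> nat" where
  "valency V E = (THE k. \<forall>x\<in>V. card {y\<in>V. E x y} = k)"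

definition adj_eigenvalue :: "'a set \<Rightarrow> ('a \<Rightarrow> 'a \<Rightarrow> bool) \<Rightarrow> real \<Rightarrow> bool" where
  "adj_eigenvalue V E \<theta> \<longleftrightarrow> (\<exists>f :: 'a \<Rightarrow> real. (\<exists>x\<in>V. f x \<noteq> 0) \<and>
      (\<forall>x\<in>V. (\<Sum>y\<in>{y\<in>V. E x y}. f y) = \<theta> * f x))"

definition smallest_eigenvalue :: "'a set \<Rightarrow> ('a \<Rightarrow> 'a \<Rightarrow> bool) \<Rightarrow> real" where
  "smallest_eigenvalue V E = Min {\<theta>. adj_eigenvalue V E \<theta>}"

definition is_clique :: "'a set \<Rightarrow> ('a \<Rightarrow> 'a \<Rightarrow> bool) \<Rightarrow> 'a set \<Rightarrow> bool" where
  "is_clique V E C \<longleftrightarrow> C \<subseteq> V \<and> (\<forall>x\<in>C. \<forall>y\<in>C. x \<noteq> y \<longrightarrow> E x y)"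

definition delsarte_clique :: "'a set \<Rightarrow> ('a \<Rightarrow> 'a \<Rightarrow> bool) \<Rightarrow> 'a set \<Rightarrow> bool" where
  "delsarte_clique V E C \<longleftrightarrow> is_clique V E C \<and>
     real (card C) = 1 + real (valency V E) / (- smallest_eigenvalue V E)"

definition geometric :: "'a set \<Rightarrow> ('a \<Rightarrow> 'a \<Rightarrow> bool) \<Rightarrow> bool" where
  "geometric V E \<longleftrightarrow> distance_regular V E \<and> \<not> complete_graph V E \<and>
     (\<exists>\<C>. (\<forall>C\<in>\<C>. delsarte_clique V E C) \<and>
          (\<forall>x y. E x y \<longrightarrow> (\<exists>!C. C \<in> \<C> \<and> x \<in> C \<and> y \<in> C)))"

definition graph_iso :: "'a set \<Rightarrow> ('a \<Rightarrow> 'a \<Rightarrow> bool) \<Rightarrow> 'b set \<Rightarrow> ('b \<Rightarrow> 'b \<Rightarrow> bool) \<Rightarrow> bool" where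
  "graph_iso V E W F \<longleftrightarrow> (\<exists>f. bij_betw f V W \<and> (\<forall>x\<in>V. \<forall>y\<in>V. E x y \<longleftrightarrow> F (f x) (f y)))"

end

theory Submission
  imports Defs "HOL-Analysis.Analysis" "HOL-Library.Ramsey"
begin

text \<open>It suffices to bound the number of vertices, so we bound the valency \<open>k\<close> in terms of \<open>m\<close> and the
  diameter in terms of \<open>k\<close>.

  Diameter: by an argument of Ivanov, after a change of \<open>(c\<^sub>i, b\<^sub>i)\<close> at position \<open>i \<ge> 2\<close> there is another
  change before \<open>2 i + 1\<close>. Since \<open>c\<^sub>1 = 1 < c\<^sub>2\<close> and \<open>c\<^sub>i - b\<^sub>i\<close> takes at most \<open>2 k + 1\<close> values, the diameter
  is less than \<open>2^(2 k + 2)\<close>.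

  Valency: \<open>A + m I\<close> is positive semidefinite, which forbids large claws and vertices adjacent to
  exactly half of a large clique. Hence \<open>\<lambda>\<close> is linear in \<open>k\<close>. If \<open>c\<^sub>2\<close> is large, Ramsey's theorem and the
  second forbidden configuration force every vertex to have boundedly many non-neighbours, and
  coconnectedness bounds the order. If \<open>c\<^sub>2\<close> is bounded and \<open>k\<close> is large, the large maximal cliques
  partition the edges (Bose--Laskar), every vertex lies on the same number \<open>\<tau>\<close> of them, and there are
  fewer of them than vertices; so \<open>-\<tau>\<close> is the smallest eigenvalue, and Delsarte's clique bound
  makes all of them Delsarte cliques, i.e. the graph is geometric.\<close>

section \<open>Distances in a connected graph\<close>

text \<open>The split on \<open>c_2\<close> is made at a Ramsey number that depends on
  \<open>m\<close> only. Above it, the common neighbourhood of two vertices at distance two contains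
  a clique large enough for the half-clique argument; below it, \<lambda> can be required to be
  large compared with the bound on \<open>c_2\<close>, which the Bose-Laskar argument needs. The
  constants are therefore fixed in the order Ramsey numbers, threshold for \<lambda>, valency,
  order. Claws give \<open>k \<le> m^2 (\<lambda> + 1)\<close>, so a small \<lambda> means a small
  valency, and this is the case in which the diameter bound is used.

  The spectral part does not diagonalise \<open>A\<close>. The smallest eigenvalue is the minimum of
  the quadratic form on the unit sphere, attained by compactness. Delsarte's bound comes from the
  positivity of all powers of \<open>k I - A\<close>: distance-regularity makes their entries
  functions of the distance, the indicator vector of a clique limits the growth of the diagonal, and
  the diagonal limits every eigenvalue.\<close>

locale graph_metric =
  fixes V :: "'a set" and E :: "'a \<Rightarrow> 'a \<Rightarrow> bool"
  assumes simple: "simple_graph V E" and conn: "connected_graph V E"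
begin

abbreviation d :: "'a \<Rightarrow> 'a \<Rightarrow> nat" where "d \<equiv> gdist E"

abbreviation nb :: "'a \<Rightarrow> 'a set" where "nb x \<equiv> {y. E x y}"

lemma finV [simp]: "finite V" and E_in: "E x y \<Longrightarrow> x \<in> V \<and> y \<in> V"
  and E_sym: "E x y \<Longrightarrow> E y x" and E_irr [simp]: "\<not> E x x"
  using simple unfolding simple_graph_def by auto

lemma E_commute: "E x y \<longleftrightarrow> E y x"
  using E_sym by blast

lemma V_ne: "V \<noteq> {}"
  using conn unfolding connected_graph_def by auto

lemma nb_sub: "nb x \<subseteq> V"
  using E_in by auto

lemma fin_nb [simp]: "finite (nb x)"
  using finite_subset[OF nb_sub finV] .

lemma fin_sub_nb [simp]: "finite {z. E y z \<and> P z}"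
  by (rule finite_subset[OF _ fin_nb[of y]]) auto

lemma walk_append: "walk E n y z \<Longrightarrow> walk E m x y \<Longrightarrow> walk E (m + n) x z"
  by (induction rule: walk.induct) (auto intro: walk.intros)

lemma walk_sym: "walk E n x y \<Longrightarrow> walk E n y x"
proof (induction rule: walk.induct)
  case (walk0 x)
  then show ?case by (rule walk.walk0)
next
  case (walkS n x y z)
  have "walk E 1 z y"
    using walk.walkS[of E 0 z z y] E_sym[OF walkS.hyps(2)] walk.walk0[of E z] by simp
  from walk_append[OF walkS.IH this] show ?case by simp
qed

lemma ex_walk: "x \<in> V \<Longrightarrow> y \<in> V \<Longrightarrow> \<exists>n. walk E n x y"
  using conn unfolding connected_graph_def by auto

lemma walk_d: "x \<in> V \<Longrightarrow> y \<in> V \<Longrightarrow> walk E (d x y) x y"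
  unfolding gdist_def using ex_walk by (rule LeastI_ex)

lemma d_le: "walk E n x y \<Longrightarrow> d x y \<le> n"
  unfolding gdist_def by (rule Least_le)

lemma d_refl [simp]: "d x x = 0"
  using d_le[OF walk.walk0] by simp

lemma d_zero: "x \<in> V \<Longrightarrow> y \<in> V \<Longrightarrow> d x y = 0 \<longleftrightarrow> x = y"
  using walk_d[of x y] by (auto elim: walk.cases)

lemma d_sym: "x \<in> V \<Longrightarrow> y \<in> V \<Longrightarrow> d x y = d y x"
  by (meson d_le le_antisym walk_d walk_sym)

lemma d_tri: "x \<in> V \<Longrightarrow> y \<in> V \<Longrightarrow> z \<in> V \<Longrightarrow> d x z \<le> d x y + d y z"
  by (meson d_le walk_append walk_d)

lemma d_one: "x \<in> V \<Longrightarrow> y \<in> V \<Longrightarrow> d x y = 1 \<longleftrightarrow> E x y"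
proof
  assume xy: "x \<in> V" "y \<in> V" "d x y = 1"
  then have "walk E (Suc 0) x y" using walk_d[of x y] by simp
  then obtain z where "walk E 0 x z" "E z y" by (cases rule: walk.cases) auto
  then show "E x y" by (auto elim: walk.cases)
next
  assume xy: "x \<in> V" "y \<in> V" "E x y"
  have "walk E 1 x y" using walk.walkS[of E 0 x x y] walk.walk0[of E x] xy(3) by simp
  from d_le[OF this] have "d x y \<le> 1" .
  moreover have "d x y \<noteq> 0" using d_zero[OF xy(1,2)] xy(3) by auto
  ultimately show "d x y = 1" by simp
qed

lemma d_edge: "E x y \<Longrightarrow> d x y = 1"
  using d_one E_in by blast

lemma d_step: "x \<in> V \<Longrightarrow> E y z \<Longrightarrow> d x z \<le> d x y + 1"
  by (metis E_in d_edge d_tri)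

lemma d_step2: "x \<in> V \<Longrightarrow> E y z \<Longrightarrow> d x y \<le> d x z + 1"
  using d_step E_sym by blast

lemma d_pred: "x \<in> V \<Longrightarrow> y \<in> V \<Longrightarrow> d x y = Suc n \<Longrightarrow> \<exists>z. E z y \<and> d x z = n"
proof -
  assume xy: "x \<in> V" "y \<in> V" "d x y = Suc n"
  then have "walk E (Suc n) x y" using walk_d[of x y] by simp
  then obtain z where z: "walk E n x z" "E z y" by (cases rule: walk.cases) auto
  then have "d x z = n" using d_le[OF z(1)] d_step[OF xy(1) z(2)] xy(3) by simp
  then show ?thesis using z by auto
qed

lemma d_succ: "x \<in> V \<Longrightarrow> y \<in> V \<Longrightarrow> d x y = Suc n \<Longrightarrow> \<exists>z. E x z \<and> d z y = n"
  by (metis E_in E_sym d_pred d_sym)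

lemma d_between:
  "x \<in> V \<Longrightarrow> y \<in> V \<Longrightarrow> n \<le> d x y \<Longrightarrow> \<exists>z\<in>V. d x z = n \<and> d z y = d x y - n"
proof (induction "d x y - n" arbitrary: n)
  case 0
  then show ?case by (intro bexI[of _ y]) auto
next
  case (Suc r)
  then have "r = d x y - (n + 1)" "n + 1 \<le> d x y" by auto
  from Suc.hyps(1)[OF this(1) Suc.prems(1,2) this(2)]
  obtain z where z: "z \<in> V" "d x z = n + 1" "d z y = d x y - (n + 1)" by blast
  then obtain u where u: "E u z" "d x u = n" using d_pred[of x z n] Suc by auto
  have "u \<in> V" using u E_in by blast
  have "d u y \<le> 1 + d z y" using d_tri[of u z y] u z Suc.prems E_in d_edge by metis
  moreover have "d x y \<le> d x u + d u y" using d_tri Suc.prems \<open>u \<in> V\<close> by blast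
  ultimately show ?case using u z Suc \<open>u \<in> V\<close> by (intro bexI[of _ u]) auto
qed

lemma card_ball: "x \<in> V \<Longrightarrow> \<forall>y\<in>V. card (nb y) \<le> k \<Longrightarrow> card {y\<in>V. d x y \<le> n} \<le> (k + 1) ^ n"
proof (induction n)
  case 0
  then have "{y\<in>V. d x y \<le> 0} = {x}" using d_zero by auto
  then show ?case by simp
next
  case (Suc n)
  let ?B = "{y\<in>V. d x y \<le> n}"
  have "{y\<in>V. d x y \<le> Suc n} \<subseteq> (\<Union>z\<in>?B. insert z (nb z))"
  proof
    fix y assume y: "y \<in> {y\<in>V. d x y \<le> Suc n}"
    show "y \<in> (\<Union>z\<in>?B. insert z (nb z))"
    proof (cases "d x y \<le> n")
      case False
      then obtain z where "E z y" "d x z = n" using d_pred[of x y n] y Suc.prems by auto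
      then show ?thesis using E_in by blast
    qed (use y in auto)
  qed
  then have "card {y\<in>V. d x y \<le> Suc n} \<le> card (\<Union>z\<in>?B. insert z (nb z))"
    by (intro card_mono) auto
  also have "\<dots> \<le> (\<Sum>z\<in>?B. card (insert z (nb z)))" by (rule card_UN_le) simp
  also have "\<dots> \<le> (\<Sum>z\<in>?B. k + 1)"
  proof (rule sum_mono)
    fix z assume "z \<in> ?B"
    then have "card (nb z) \<le> k" using Suc.prems by auto
    then show "card (insert z (nb z)) \<le> k + 1" by (simp add: card_insert_if)
  qed
  also have "\<dots> = card ?B * (k + 1)" by simp
  also have "\<dots> \<le> (k + 1) ^ n * (k + 1)" using Suc mult_le_mono1 by blast
  finally show ?case by (simp add: mult.commute)
qed

end

section \<open>Intersection numbers and the diameter bound\<close>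

text \<open>The values of \<open>b\<close> and \<open>c\<close> beyond the diameter are arbitrary,
  so monotonicity and bounds are stated through vertices whose distance realises or exceeds the
  index. \<open>b 0\<close> is the valency.\<close>

locale drg = graph_metric +
  fixes b c :: "nat \<Rightarrow> nat"
  assumes card_c: "x \<in> V \<Longrightarrow> y \<in> V \<Longrightarrow> card {z. E y z \<and> d x z + 1 = d x y} = c (d x y)"
    and card_b: "x \<in> V \<Longrightarrow> y \<in> V \<Longrightarrow> card {z. E y z \<and> d x z = d x y + 1} = b (d x y)"
begin

abbreviation "Cs x y \<equiv> {z. E y z \<and> d x z + 1 = d x y}"
abbreviation "Bs x y \<equiv> {z. E y z \<and> d x z = d x y + 1}"

lemma card_nb: "x \<in> V \<Longrightarrow> card (nb x) = b 0"
proof -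
  assume x: "x \<in> V"
  have "Bs x x = nb x" using d_edge by auto
  then show ?thesis using card_b[OF x x] by simp
qed

lemma c_zero [simp]: "c 0 = 0"
  using card_c V_ne by fastforce

lemma c_one: "E x y \<Longrightarrow> c 1 = 1"
proof -
  assume xy: "E x y"
  then have "Cs x y = {x}" using d_edge[OF xy] d_zero E_in E_sym by auto
  then show ?thesis using card_c[of x y] d_edge[OF xy] E_in[OF xy] by simp
qed

lemma b_le: "x \<in> V \<Longrightarrow> y \<in> V \<Longrightarrow> b (d x y) \<le> b 0"
  using card_mono[of "nb y" "Bs x y"] card_b card_nb by fastforce

lemma c_le: "x \<in> V \<Longrightarrow> y \<in> V \<Longrightarrow> c (d x y) \<le> b 0"
  using card_mono[of "nb y" "Cs x y"] card_c card_nb by fastforce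

lemma c_pos: "x \<in> V \<Longrightarrow> y \<in> V \<Longrightarrow> d x y = Suc n \<Longrightarrow> Cs x y \<noteq> {}"
  using d_pred[of x y n] E_sym by auto

text \<open>A geodesic from \<open>u\<close> to \<open>p\<close> extends by the edge
  \<open>w u\<close>, so a step from \<open>p\<close> towards \<open>u\<close> is also a step
  towards \<open>w\<close>. Where the intersection numbers agree, the inclusion is an equality by
  cardinality; the run argument rests on this.\<close>

lemma Cs_mono:
  assumes "p \<in> V" "E w u" "d w p = d u p + 1"
  shows "Cs u p \<subseteq> Cs w p"
proof
  fix z assume z: "z \<in> Cs u p"
  have wu: "w \<in> V" "u \<in> V" "z \<in> V" using assms E_in z by auto
  have "d w z \<le> d w u + d u z" using d_tri wu by blast
  then have "d w z \<le> d u z + 1" using d_edge[OF assms(2)] by simp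
  moreover have "d w p \<le> d w z + 1" using d_step2[of w p z] z wu d_step E_sym by blast
  ultimately show "z \<in> Cs w p" using z assms by auto
qed

lemma Bs_mono:
  assumes "p \<in> V" "E w u" "d w p = d u p + 1"
  shows "Bs w p \<subseteq> Bs u p"
proof
  fix z assume z: "z \<in> Bs w p"
  have wu: "w \<in> V" "u \<in> V" "z \<in> V" using assms E_in z by auto
  have "d w z \<le> d w u + d u z" using d_tri wu by blast
  then have "d w z \<le> d u z + 1" using d_edge[OF assms(2)] by simp
  moreover have "d u z \<le> d u p + 1" using d_step[of u p z] z wu by blast
  ultimately show "z \<in> Bs u p" using z assms by auto
qed

lemma c_mono_step: "x \<in> V \<Longrightarrow> y \<in> V \<Longrightarrow> Suc n \<le> d x y \<Longrightarrow> c n \<le> c (Suc n) \<and> b (Suc n) \<le> b n"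
proof -
  assume xy: "x \<in> V" "y \<in> V" "Suc n \<le> d x y"
  then obtain p where p: "p \<in> V" "d x p = Suc n" using d_between by blast
  then obtain u where u: "E x u" "d u p = n" using d_succ xy by blast
  have uV: "u \<in> V" using u E_in by blast
  have "card (Cs u p) \<le> card (Cs x p)" "card (Bs x p) \<le> card (Bs u p)"
    using Cs_mono[of p x u] Bs_mono[of p x u] p u by (auto intro!: card_mono)
  then show ?thesis
    using card_c[OF uV p(1)] card_c[OF xy(1) p(1)] card_b[OF uV p(1)] card_b[OF xy(1) p(1)] p u
    by simp
qed

lemma c_mono:
  assumes "x \<in> V" "y \<in> V" "l \<le> n" "n \<le> d x y"
  shows "c l \<le> c n \<and> b n \<le> b l"
  using assms(3,4)
proof (induction n rule: dec_induct)
  case (step n)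
  then show ?case using c_mono_step[OF assms(1,2), of n] by auto
qed simp

end

text \<open>If \<open>(c\<^sub>n, b\<^sub>n)\<close> is constant for \<open>i \<le> n \<le> 2 i\<close>, then \<open>d w - d u\<close> is locally constant on the vertices
  far from an edge \<open>w u\<close>. A change of \<open>b\<close> or \<open>c\<close> between \<open>i - 1\<close> and \<open>i\<close> then produces two vertices with
  more than \<open>c\<^sub>i\<close> neighbours on geodesics between them.\<close>

locale drg_run = drg +
  fixes i :: nat
  assumes i2: "2 \<le> i"
    and run: "i \<le> n \<Longrightarrow> n \<le> 2 * i \<Longrightarrow> c n = c i \<and> b n = b i"
begin

text \<open>Constancy of \<open>c\<close> and \<open>b\<close> turns \<open>Cs_mono\<close> and
  \<open>Bs_mono\<close> into equalities, so a neighbour of \<open>p\<close> is closer, farther or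
  level alike from \<open>u\<close> and from \<open>w\<close>.\<close>

lemma run_vertical:
  assumes pV: "p \<in> V" and wu: "E w u" and dd: "d w p = d u p + 1"
    and n: "i \<le> d u p" "d u p < 2 * i" and v: "E p v"
  shows "d w v = d u v + 1"
proof -
  have V: "w \<in> V" "u \<in> V" "v \<in> V" using E_in wu v by auto
  have "c (d w p) = c (d u p)" "b (d w p) = b (d u p)"
    using run[of "d u p"] run[of "d w p"] dd n by auto
  then have Cs: "Cs u p = Cs w p" and Bs: "Bs w p = Bs u p"
    using card_subset_eq[OF _ Cs_mono[OF pV wu dd]] card_subset_eq[OF _ Bs_mono[OF pV wu dd]]
      card_c[OF V(1) pV] card_c[OF V(2) pV] card_b[OF V(1) pV] card_b[OF V(2) pV] by auto
  consider "v \<in> Cs u p" | "v \<in> Bs u p" | "d u v = d u p"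
    using d_step[OF V(2) v] d_step2[OF V(2) v] v by force
  then show ?thesis
  proof cases
    case 1
    then have "v \<in> Cs w p" using Cs by blast
    then show ?thesis using 1 dd by auto
  next
    case 2
    then have "v \<in> Bs w p" using Bs by blast
    then show ?thesis using 2 dd by auto
  next
    case 3
    then have "v \<notin> Cs u p" "v \<notin> Bs u p" by auto
    then have "v \<notin> Cs w p" "v \<notin> Bs w p" using Cs Bs by (simp_all only: not_False_eq_True)
    then show ?thesis using 3 dd v d_step[OF V(1) v] d_step2[OF V(1) v] by force
  qed
qed

text \<open>Otherwise \<open>z w\<close> is vertical as seen from \<open>v\<close>, and
  \<open>run_vertical\<close> carries this back along \<open>v p\<close> to \<open>p\<close>. The
  lower bound on \<open>n\<close> is strict because the distance to \<open>v\<close> may be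
  \<open>n - 1\<close>.\<close>

lemma run_horizontal_le:
  assumes "E w z" "E p v" "d w p = n" "d z p = n" "i < n" "n < 2 * i"
  shows "d z v \<le> d w v"
proof (rule ccontr)
  assume a: "\<not> d z v \<le> d w v"
  have V: "w \<in> V" "z \<in> V" "p \<in> V" "v \<in> V" using E_in assms by auto
  have "d v z \<le> d v w + 1" using d_step[OF V(4) assms(1)] .
  then have eq: "d z v = d w v + 1" using a d_sym V by simp
  have b1: "n \<le> d w v + 1" "d z v \<le> n + 1"
    using d_step2[OF V(1) assms(2)] d_step[OF V(2) assms(2)] assms(3,4) by auto
  have "d z p = d w p + 1"
    using run_vertical[OF V(4) E_sym[OF assms(1)] eq _ _ E_sym[OF assms(2)]] b1 eq assms by auto
  then show False using assms by simp
qed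

lemma run_horizontal:
  assumes "E w z" "E p v" "d w p = d z p" "i < d w p" "d w p < 2 * i"
  shows "d w v = d z v"
  using run_horizontal_le[OF assms(1,2) refl] run_horizontal_le[OF E_sym[OF assms(1)] assms(2) refl] assms by auto

text \<open>Iterates \<open>run_vertical\<close> along a geodesic from \<open>w\<close> to
  \<open>u\<close>: within the run, \<open>u\<close> stays between \<open>w\<close> and
  \<open>p\<close> when \<open>p\<close> moves to a neighbour.\<close>

lemma run_geodesic:
  assumes "w \<in> V" "u \<in> V" "E p v" "d w u + d u p = d w p" "i \<le> d u p" "d w p \<le> 2 * i"
  shows "d w v = d w u + d u v"
  using assms
proof (induction "d w u" arbitrary: w)
  case 0
  then show ?case using d_zero by auto
next
  case (Suc n)
  then obtain t where t: "E w t" "d t u = n" using d_succ[of w u n] by auto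
  have tV: "t \<in> V" "p \<in> V" using t E_in Suc by auto
  have "d t p \<le> n + d u p" using d_tri[of t u p] t tV Suc by auto
  moreover have "d w p \<le> d t p + 1" using d_tri[of w t p] d_edge[OF t(1)] tV Suc by auto
  ultimately have tp: "d t p = n + d u p" "d w p = d t p + 1" using Suc by auto
  have "d w v = d t v + 1" using run_vertical[OF tV(2) t(1) tp(2) _ _ Suc.prems(3)] tp Suc by auto
  moreover have "d t v = d t u + d u v" using Suc.hyps(1)[of t] t tp tV Suc.prems by auto
  ultimately show ?case using Suc.hyps(2) t by simp
qed

text \<open>The propagation rule is a hypothesis because two thresholds occur: \<open>l = i\<close>
  comes from \<open>run_horizontal\<close>, and \<open>l = i - 1\<close> becomes available when
  \<open>b (i - 1) = b i\<close>.\<close>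

lemma horizontal_geodesic:
  assumes F2': "\<And>u u'. E u u' \<Longrightarrow> d p u = d q u \<Longrightarrow> l < d p u \<Longrightarrow> d p u < 2 * i \<Longrightarrow> d p u' = d q u'"
    and "w \<in> V" "u \<in> V" "E p q" "d w p = d w q" "d w u + d u p = d w p"
    "l \<le> d u p" "d w p < 2 * i"
  shows "d u q = d u p"
  using assms(2-)
proof (induction "d w u" arbitrary: w)
  case 0
  then show ?case using d_zero by auto
next
  case (Suc n)
  then obtain t where t: "E w t" "d t u = n" using d_succ[of w u n] by auto
  have tV: "t \<in> V" "p \<in> V" "q \<in> V" using t E_in Suc by auto
  have "d t p \<le> n + d u p" using d_tri[of t u p] t tV Suc by auto
  moreover have "d w p \<le> d t p + 1" using d_tri[of w t p] d_edge[OF t(1)] tV Suc by auto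
  ultimately have tp: "d t p = n + d u p" "d w p = d t p + 1" using Suc by auto
  have "d p t = d q t"
    using F2'[OF t(1)] tp Suc d_sym tV by simp
  then have "d t p = d t q" using d_sym tV by simp
  then show ?case using Suc.hyps(1)[of t] t tp tV Suc.prems by auto
qed

text \<open>On a geodesic from \<open>w\<close> through \<open>y\<close> and \<open>x\<close> to
  \<open>e\<close>, the drop of \<open>b\<close> makes some neighbour of \<open>e\<close> farther
  from \<open>x\<close> but not from \<open>y\<close>; it turns off the geodesic horizontally as
  seen from \<open>y\<close> and \<open>w\<close>. The configuration is invariant under reversal,
  and both ends are used.\<close>

lemma b_drop_turn:
  assumes V: "w \<in> V" "y \<in> V" "x \<in> V" "e \<in> V" and yx: "E y x"
    and dd: "d w y + 1 = i" "d w x = i" "d x e + 1 = i" "d y e = i" "d w e + 1 = 2 * i"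
    and drop: "b i < b (i - 1)"
  shows "\<exists>W. E e W \<and> d x W = i \<and> d y W = i \<and> d w W = d w e"
proof -
  have "card (Bs y e) < card (Bs x e)"
    using card_b[OF V(3,4)] card_b[OF V(2,4)] drop dd(3,4) by (metis add_diff_cancel_right')
  then obtain W where W: "W \<in> Bs x e" "W \<notin> Bs y e"
    using card_mono[of "Bs y e" "Bs x e"] by fastforce
  then have eW: "E e W" and xW: "d x W = i" and yW: "d y W \<noteq> i + 1" using dd by auto
  have WV: "W \<in> V" using E_in eW by blast
  have sym: "E x y" using yx E_sym by blast
  have wy: "d w W = d w y + d y W"
    using run_geodesic[OF V(1,2) eW] dd by auto
  have yW2: "d y W \<le> i + 1" "i \<le> d y W + 1"
    using d_step[OF V(2) eW] d_step2[OF V(2) eW] dd by auto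
  have "d y W \<noteq> i - 1"
  proof
    assume yl: "d y W = i - 1"
    have sub: "Cs w x \<subseteq> Cs W x"
    proof
      fix t assume t: "t \<in> Cs w x"
      then have tV: "t \<in> V" using E_in by blast
      have "d t e \<le> d t x + d x e" "d w e \<le> d w t + d t e" using d_tri tV V by auto
      moreover have "d t x = 1" using t d_edge E_sym by auto
      ultimately have te: "d t e = i" using t dd by auto
      have "d w W = d w t + d t W"
        using run_geodesic[OF V(1) tV eW] te t dd by auto
      then have "d t W + 1 = i" using t dd wy yl i2 by auto
      then show "t \<in> Cs W x" using t xW d_sym WV V tV by auto
    qed
    have "card (Cs w x) = card (Cs W x)"
      using card_c[OF V(1,3)] card_c[OF WV V(3)] dd xW d_sym[OF WV V(3)] by simp
    then have eq: "Cs w x = Cs W x" using card_subset_eq[OF _ sub] by simp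
    \<comment> \<open>A step \<open>r\<close> from \<open>x\<close> towards \<open>e\<close> is also
      a step towards \<open>W\<close>, hence towards \<open>w\<close>; then \<open>w\<close> and
      \<open>e\<close> would be at distance at most \<open>2 i - 3\<close>.\<close>
    have "d e x = Suc (i - 2)" using dd i2 d_sym V by simp
    from c_pos[OF V(4,3) this] obtain r where r: "r \<in> Cs e x" by blast
    have rV: "r \<in> V" using r E_in by blast
    have "d W r \<le> d W e + d e r" using d_tri WV V rV by blast
    then have "d W r \<le> 1 + (i - 2)" using d_edge[OF E_sym[OF eW]] r dd d_sym V by auto
    moreover have "d W x \<le> d W r + 1" using d_step2[OF WV, of x r] r E_sym d_step[OF WV] by blast
    ultimately have "r \<in> Cs W x" using r xW d_sym[OF WV V(3)] i2 by auto
    then have "r \<in> Cs w x" using eq by blast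
    moreover have "d w e \<le> d w r + d r e" using d_tri V rV by blast
    moreover have "d r e + 2 = i" using r dd d_sym[OF rV V(4)] d_sym[OF V(4,3)] by auto
    ultimately show False using dd by auto
  qed
  then have "d y W = i" using yW yW2 by linarith
  then show ?thesis using eW xW wy dd by (intro exI[of _ W]) auto
qed

text \<open>A neighbour \<open>v\<close> of \<open>W\<close> one step closer to \<open>w\<close>
  must be at distance \<open>i - 1\<close> from \<open>x\<close>: otherwise \<open>Cs v x\<close>
  contains both \<open>Cs w x\<close> and \<open>Cs z x\<close>, two different sets of the same size
  \<open>c i\<close>. Hence \<open>Cs w W\<close> and \<open>Cs x W\<close> coincide, although
  \<open>e\<close> lies only in the second.\<close>

lemma no_b_drop:
  assumes V: "w0 \<in> V" "e0 \<in> V" "2 * i \<le> d w0 e0" and drop: "b i < b (i - 1)"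
  shows False
proof -
  have "2 * i - 1 \<le> d w0 e0" using V by linarith
  from d_between[OF V(1,2) this] obtain e where e: "e \<in> V" "d w0 e = 2 * i - 1" by blast
  define w where "w = w0"
  have w: "w \<in> V" "d w e + 1 = 2 * i" using V e i2 w_def by auto
  obtain x where x: "x \<in> V" "d w x = i" "d x e + 1 = i" using d_between[of w e i] w e i2 by auto
  obtain y where y: "E y x" "d w y + 1 = i" using d_pred[of w x "i-1"] w x i2 by auto
  have yV: "y \<in> V" using y E_in by blast
  have xy: "E x y" using y E_sym by blast
  have ye: "d y e = i"
    using d_tri[of w y e] d_tri[of y x e] d_edge[OF y(1)] w x y yV e by auto
  note sy = d_sym[OF e(1) x(1)] d_sym[OF e(1) yV] d_sym[OF w(1) yV] d_sym[OF w(1) x(1)] d_sym[OF w(1) e(1)]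
  obtain W where W: "E e W" "d x W = i" "d y W = i" "d w W = d w e"
    using b_drop_turn[OF w(1) yV x(1) e(1) y(1) _ x(2,3) ye w(2) drop] y by auto
  obtain z where z: "E w z" "d y z = i" "d x z = i" "d e z = d e w"
    using b_drop_turn[OF e(1) x(1) yV w(1) xy _ _ _ _ _ drop] sy x y ye w by auto
  have WV: "W \<in> V" and zV: "z \<in> V" using W z E_in by auto
  have F2r: "\<And>u u'. E u u' \<Longrightarrow> d e u = d W u \<Longrightarrow> i < d e u \<Longrightarrow> d e u < 2 * i \<Longrightarrow> d e u' = d W u'"
    using run_horizontal[OF W(1)] .
  have ze: "d z e = d w e" using z(4) d_sym zV w e by metis
  have zW: "d z W = d w e"
    using run_horizontal[OF z(1) W(1)] ze W(4) w i2 by auto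
  \<comment> \<open>Both values of \<open>s\<close> behave alike because \<open>w z\<close> is
    horizontal: \<open>z\<close> is as far as \<open>w\<close> from \<open>e\<close>,
    \<open>W\<close> and \<open>v\<close>.\<close>
  have lift: "\<And>t v. E x t \<Longrightarrow> d s t + 1 = i \<Longrightarrow> s \<in> {w, z} \<Longrightarrow> E W v \<Longrightarrow> d w v + 1 = d w W \<Longrightarrow>
       d t v + 1 = i" for s
  proof -
    fix t v assume t: "E x t" "d s t + 1 = i" and s: "s \<in> {w, z}" and v: "E W v" "d w v + 1 = d w W"
    have tV: "t \<in> V" and vV: "v \<in> V" and sV: "s \<in> V" using t v E_in s w zV by auto
    have se: "d s e + 1 = 2 * i" "d s W = d s e" using s ze zW w W by auto
    have "d t e \<le> 1 + d x e" using d_tri[of t x e] d_edge[OF E_sym[OF t(1)]] tV x e by auto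
    moreover have "d s e \<le> d s t + d t e" using d_tri sV tV e by blast
    ultimately have te: "d t e = i" using t se x by auto
    have tW: "d t W = i"
      using horizontal_geodesic[of e W i s t, OF F2r sV tV W(1)] se te t by auto
    have sv: "d s v + 1 = d s W"
    proof (cases "s = w")
      case False
      then have "s = z" using s by simp
      moreover have "d w v = d z v" using run_horizontal[OF z(1) v(1)] zW W(4) w i2 by auto
      ultimately show ?thesis using v zW W by auto
    qed (use v in simp)
    have "d s v = d s t + d t v" using run_geodesic[OF sV tV v(1)] tW se t by auto
    then show "d t v + 1 = i" using sv se t by auto
  qed
  have cwx: "card (Cs w x) = c i" and czx: "card (Cs z x) = c i"
    using card_c[OF w(1) x(1)] card_c[OF zV x(1)] x z d_sym zV by auto
  have y1: "y \<in> Cs w x" "y \<notin> Cs z x" using xy x y z d_sym zV yV by auto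
  have le: "d x v + 1 = i" if v: "v \<in> Cs w W" for v
  proof -
    have vV: "v \<in> V" using v E_in by blast
    have "d y v + 1 = i" using lift[of y w v] v y xy by auto
    then have "d x v \<le> i" using d_tri[of x y v] d_edge[OF xy] x yV vV by auto
    moreover have "d x v \<noteq> i"
    proof
      assume xv: "d x v = i"
      have sub: "Cs w x \<subseteq> Cs v x" "Cs z x \<subseteq> Cs v x"
      proof safe
        fix t assume t: "E x t" "d w t + 1 = d w x"
        then have "d t v + 1 = i" using lift[of t w v] v x by auto
        then show "d v t + 1 = d v x" using xv d_sym E_in t vV x by metis
      next
        fix t assume t: "E x t" "d z t + 1 = d z x"
        then have "d z t + 1 = i" using z(3) d_sym zV x by metis
        then have "d t v + 1 = i" using lift[of t z v] v x t by auto
        then show "d v t + 1 = d v x" using xv d_sym E_in t vV x by metis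
      qed
      have "card (Cs v x) = c i" using card_c[OF vV x(1)] xv d_sym vV x by simp
      then have "Cs w x = Cs v x" "Cs z x = Cs v x"
        using cwx czx card_subset_eq[OF fin_sub_nb sub(1)] card_subset_eq[OF fin_sub_nb sub(2)]
        by presburger+
      then show False using y1 by blast
    qed
    moreover have "i \<le> d x v + 1" using d_step2[OF x(1), of W v] d_step[OF x(1), of v W] v W E_sym by auto
    ultimately show ?thesis by linarith
  qed
  have "Cs w W \<subseteq> Cs x W" using le W by auto
  moreover have "card (Cs w W) = c i" "card (Cs x W) = c i"
    using card_c[OF w(1) WV] card_c[OF x(1) WV] W w run[of "d w e"] i2 by auto
  ultimately have "Cs w W = Cs x W" by (intro card_subset_eq) auto
  moreover have "e \<in> Cs x W" using W E_sym x by auto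
  ultimately have "e \<in> Cs w W" by blast
  then show False using W by auto
qed

text \<open>The jump of \<open>c\<close> yields \<open>W\<close>, a step from \<open>e\<close>
  towards \<open>w\<close> but not towards \<open>x\<close>. Comparing \<open>Bs x W\<close> with
  \<open>Bs y W\<close>, sets of equal size, yields \<open>F\<close> next to \<open>W\<close>,
  farther from \<open>x\<close> but not from \<open>y\<close>. Then \<open>Cs F x\<close>, of size
  \<open>c i\<close>, contains \<open>Cs w x\<close>, of the same size, and also
  \<open>Cs W x\<close>, which cannot lie inside \<open>Cs w x\<close>.\<close>

lemma no_c_jump:
  assumes V: "w0 \<in> V" "e0 \<in> V" "2 * i \<le> d w0 e0" and jump: "c (i - 1) < c i" and beq: "b (i - 1) = b i"
  shows False
proof -
  obtain e where e: "e \<in> V" "d w0 e = 2 * i" using d_between[of w0 e0 "2*i"] V by auto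
  define w where "w = w0"
  have w: "w \<in> V" "d w e = 2 * i" using V e i2 w_def by auto
  obtain x where x: "x \<in> V" "d w x = i + 1" "d x e + 1 = i" using d_between[of w e "i+1"] w e i2 by auto
  obtain y where y: "E y x" "d w y = i" using d_pred[of w x i] w x by auto
  have yV: "y \<in> V" using y E_in by blast
  have xy: "E x y" using y E_sym by blast
  have ye: "d y e = i"
    using d_tri[of w y e] d_tri[of y x e] d_edge[OF y(1)] w x y yV e by auto
  have "card (Cs x e) < card (Cs w e)"
    using card_c[OF x(1) e(1)] card_c[OF w(1) e(1)] jump x w run[of "2*i"] i2
    by (metis add_diff_cancel_right' order_refl le_add2 mult_2)
  then obtain W where W: "W \<in> Cs w e" "W \<notin> Cs x e"
    using card_mono[of "Cs x e" "Cs w e"] by fastforce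
  then have eW: "E e W" and wW: "d w W + 1 = 2 * i" using w by auto
  have WV: "W \<in> V" using E_in eW by blast
  have lower: "d t W + 1 = i \<and> d t e = i" if t: "E x t" "d w t = i" for t
  proof -
    have tV: "t \<in> V" using E_in t by blast
    have te: "d t e = i"
      using d_tri[of w t e] d_tri[of t x e] d_edge[OF E_sym[OF t(1)]] w x t tV e by auto
    then have "d w W = d w t + d t W" using run_geodesic[OF w(1) tV eW] t w by auto
    then show ?thesis using wW t te by auto
  qed
  have cwx: "card (Cs w x) = c i" using card_c[OF w(1) x(1)] x run[of "i+1"] i2 by auto
  have xW_le: "d x W \<le> i" "i \<le> d x W + 1"
    using d_step[OF x(1) eW] x lower[OF xy y(2)] d_tri[of x y W] d_edge[OF xy] yV WV W eW
      d_step2[OF x(1) eW] by auto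
  \<comment> \<open>As in \<open>b_drop_turn\<close>: if \<open>Cs w x = Cs W x\<close>, a step from
    \<open>x\<close> towards \<open>e\<close> would also lead towards \<open>w\<close>.\<close>
  have "d x W \<noteq> i"
  proof
    assume xW: "d x W = i"
    have "Cs w x \<subseteq> Cs W x" using lower x xW d_sym WV E_in by fastforce
    moreover have "card (Cs W x) = c i" using card_c[OF WV x(1)] xW d_sym WV x by simp
    ultimately have eq: "Cs w x = Cs W x" using cwx by (intro card_subset_eq) auto
    have "d e x = Suc (i - 2)" using x i2 d_sym e by simp
    from c_pos[OF e(1) x(1) this] obtain r where r: "r \<in> Cs e x" by blast
    have rV: "r \<in> V" using r E_in by blast
    have "d W r \<le> d W e + d e r" using d_tri WV e rV by blast
    then have "d W r \<le> 1 + (i - 2)" using d_edge[OF E_sym[OF eW]] r x d_sym e by auto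
    moreover have "d W x \<le> d W r + 1" using d_step[OF WV, of r x] r E_sym by blast
    ultimately have "r \<in> Cs W x" using r xW d_sym[OF WV x(1)] i2 by auto
    then have "r \<in> Cs w x" using eq by blast
    moreover have "d w e \<le> d w r + d r e" using d_tri w e rV by blast
    moreover have "d r e + 2 = i" using r x d_sym[OF rV e(1)] d_sym[OF e(1) x(1)] by auto
    ultimately show False using w x by auto
  qed
  then have xW: "d x W + 1 = i" using xW_le by linarith
  have yW: "d y W + 1 = i" using lower xy y by blast
  have cB: "card (Bs x W) = card (Bs y W)"
    using card_b[OF x(1) WV] card_b[OF yV WV] xW yW by (metis add_right_cancel)
  have eB: "e \<in> Bs y W" "e \<notin> Bs x W" using E_sym[OF eW] ye yW x xW by auto
  have "\<not> Bs x W \<subseteq> Bs y W"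
  proof
    assume "Bs x W \<subseteq> Bs y W"
    from card_subset_eq[OF fin_sub_nb this cB] show False using eB by blast
  qed
  then obtain F where F: "F \<in> Bs x W" "F \<notin> Bs y W" by blast
  have WF: "E W F" and xF: "d x F = i" using F xW by auto
  have FV: "F \<in> V" using WF E_in by blast
  have yF: "d y F \<noteq> i" using F yW by auto
  \<comment> \<open>Extends the propagation to distance exactly \<open>i\<close>, where a neighbour
    may drop to \<open>i - 1\<close>, outside the run; there \<open>b (i - 1) = b i\<close> makes
    the two sets \<open>Bs\<close> equal.\<close>
  have F2': "d p u' = d q u'" if "E p q" "E u u'" "d p u = d q u" "i \<le> d p u" "d p u < 2 * i" for p q u u'
  proof (cases "d p u = i")
    case True
    have le: "d p u' \<le> d q u'" if a: "E p q" "d p u = i" "d q u = i" for p q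
    proof (rule ccontr)
      assume nle: "\<not> d p u' \<le> d q u'"
      have VV: "p \<in> V" "q \<in> V" "u \<in> V" "u' \<in> V" using a \<open>E u u'\<close> E_in by auto
      have "d u' p \<le> d u' q + 1" using d_step2[OF VV(4) a(1)] .
      then have eq: "d p u' = d q u' + 1" using nle d_sym VV by simp
      have "d q u' + 1 \<ge> i" "d p u' \<le> i + 1"
        using d_step2[OF VV(2) \<open>E u u'\<close>] d_step[OF VV(1) \<open>E u u'\<close>] a by auto
      then consider "d q u' = i" | "d q u' + 1 = i" using eq by linarith
      then show False
      proof cases
        case 1
        then have "d p u = d q u + 1" using run_vertical[OF VV(4) a(1) eq _ _ E_sym[OF \<open>E u u'\<close>]] i2 by auto
        then show False using a by simp
      next
        case 2
        have "Bs p u' \<subseteq> Bs q u'" using Bs_mono[OF VV(4) a(1) eq] .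
        moreover have "card (Bs p u') = card (Bs q u')"
          using card_b[OF VV(1,4)] card_b[OF VV(2,4)] 2 eq beq by (metis add_diff_cancel_right')
        ultimately have "Bs p u' = Bs q u'" by (intro card_subset_eq) auto
        moreover have "u \<in> Bs q u'" using 2 a E_sym[OF \<open>E u u'\<close>] by auto
        ultimately have "u \<in> Bs p u'" by blast
        then have "d p u = d p u' + 1" by blast
        then show False using eq 2 a by simp
      qed
    qed
    show ?thesis using le[of p q] le[of q p] that True E_sym by (simp add: order_antisym)
  next
    case False
    then show ?thesis using run_horizontal[of p q u u'] that by auto
  qed
  have wF: "d w F \<le> d w y + d y F" using d_tri w yV FV by blast
  have yF2: "d y F + 1 = i"
    using yF d_step[OF yV WF] yW d_tri[of x y F] d_edge[OF xy] x yV FV xF by auto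
  have key: "d t F + 1 = i" if t: "E x t" "d w t = i" for t
  proof -
    have tV: "t \<in> V" using E_in t by blast
    have tW: "d t W + 1 = i" using lower t by blast
    have tF: "d t F \<le> i" "i \<le> d t F + 1"
      using d_step[OF tV WF] tW d_tri[of x t F] d_edge[OF t(1)] x tV FV xF by auto
    \<comment> \<open>Either \<open>W F\<close> is horizontal as seen from \<open>w\<close>, or
      \<open>F\<close> is one step closer; the value of \<open>d y F\<close> excludes a step
      away.\<close>
    show ?thesis
    proof (cases "d w F = d w W")
      case True
      have "d t F = d t W"
      proof (rule horizontal_geodesic[of W F "i - 1" w t])
        fix u u' assume "E u u'" "d W u = d F u" "i - 1 < d W u" "d W u < 2 * i"
        then show "d W u' = d F u'" using F2'[OF WF] by auto
      qed (use True w tV WF t tW wW in auto)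
      then show ?thesis using tW by simp
    next
      case False
      then have wF2: "d w F + 2 = 2 * i" using wF yF2 y d_step2[OF w(1) WF] wW by auto
      show ?thesis
      proof (rule ccontr)
        assume "d t F + 1 \<noteq> i"
        then have tFi: "d t F = i" using tF by linarith
        have sub: "Cs w t \<subseteq> Cs F t"
        proof
          fix u assume u: "u \<in> Cs w t"
          have uV: "u \<in> V" using u E_in by blast
          have "d u W \<le> 1 + d t W" using d_tri[of u t W] d_edge[of u t] u E_sym uV tV WV by auto
          moreover have "d w W \<le> d w u + d u W" using d_tri w uV WV by blast
          ultimately have uW: "d u W = i" using u t tW wW by auto
          have "d w F = d w u + d u F" using run_geodesic[OF w(1) uV WF] uW u t wW by auto
          then have "d u F + 1 = i" using wF2 u t by auto
          then show "u \<in> Cs F t" using u tFi d_sym[OF FV uV] d_sym[OF FV tV] by auto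
        qed
        moreover have "card (Cs w t) = c i" "card (Cs F t) = c i"
          using card_c[OF w(1) tV] card_c[OF FV tV] t tFi d_sym[OF FV tV] by auto
        ultimately have eq: "Cs w t = Cs F t" by (intro card_subset_eq) auto
        have "d W t = Suc (i - 2)" using tW d_sym[OF WV tV] i2 by simp
        from c_pos[OF WV tV this] obtain r where r: "r \<in> Cs W t" by blast
        have rV: "r \<in> V" using r E_in by blast
        have "d F r \<le> 1 + d W r" using d_tri[of F W r] d_edge[OF E_sym[OF WF]] FV WV rV by auto
        moreover have "d F t \<le> d F r + 1" using d_step2[OF FV, of t r] d_step[OF FV, of r t] r E_sym by auto
        ultimately have "r \<in> Cs F t"
          using r tFi tW d_sym[OF FV tV] d_sym[OF WV tV] by auto
        then have "r \<in> Cs w t" using eq by blast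
        moreover have "d w W \<le> d w r + d r W" using d_tri w rV WV by blast
        ultimately show False using r t tW wW d_sym[OF WV tV] d_sym[OF WV rV] by auto
      qed
    qed
  qed
  have sub: "Cs w x \<union> Cs W x \<subseteq> Cs F x"
  proof -
    have 1: "t \<in> Cs F x" if t: "E x t" "d w t = i" for t
      using key[OF t] t xF d_sym[OF FV x(1)] d_sym[OF FV, of t] E_in by auto
    have 2: "t \<in> Cs F x" if t: "t \<in> Cs W x" for t
    proof -
      have tV: "t \<in> V" using t E_in by blast
      have "d F t \<le> 1 + d W t" using d_tri[of F W t] d_edge[OF E_sym[OF WF]] FV WV tV by auto
      moreover have "d F x \<le> d F t + 1" using d_step[OF FV, of t x] t E_sym by auto
      ultimately show ?thesis using t xF xW d_sym[OF FV x(1)] d_sym[OF WV x(1)] by auto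
    qed
    show ?thesis using 1 2 x by auto
  qed
  have cF: "card (Cs F x) = c i" using card_c[OF FV x(1)] xF d_sym[OF FV x(1)] by simp
  have "Cs w x = Cs F x" using sub cwx cF by (intro card_subset_eq) auto
  then have "Cs W x \<subseteq> Cs w x" using sub by blast
  moreover have "d W x = Suc (i - 2)" using xW d_sym[OF WV x(1)] i2 by simp
  from c_pos[OF WV x(1) this] obtain r where r: "r \<in> Cs W x" by blast
  ultimately have "d w r = i" using x by auto
  moreover have rV: "r \<in> V" using r E_in by blast
  moreover have "d w W \<le> d w r + d r W" using d_tri w rV WV by blast
  ultimately show False using r xW wW d_sym[OF WV rV] d_sym[OF WV x(1)] by auto
qed

end

section \<open>Successive changes of the intersection numbers\<close>

context drg
begin

text \<open>If nothing changed up to \<open>2 i\<close>, monotonicity would make the interval from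
  \<open>i\<close> to \<open>2 i\<close> a run. A change at \<open>i\<close> that leaves
  \<open>b\<close> constant is a jump of \<open>c\<close>, so the two impossibility lemmas cover
  every case.\<close>

lemma ivanov:
  assumes i: "2 \<le> i" and V: "w \<in> V" "e \<in> V" "2 * i \<le> d w e"
    and jump: "c (i - 1) < c i \<or> b i < b (i - 1)"
  shows "c i < c (2 * i) \<or> b (2 * i) < b i"
proof (rule ccontr)
  assume a: "\<not> ?thesis"
  have mono: "l \<le> n \<Longrightarrow> n \<le> 2 * i \<Longrightarrow> c l \<le> c n \<and> b n \<le> b l" for l n
    using c_mono[OF V(1,2)] V(3) by (meson le_trans)
  interpret drg_run V E b c i
  proof
    fix n assume n: "i \<le> n" "n \<le> 2 * i"
    then have "c i \<le> c n \<and> b n \<le> b i" "c n \<le> c (2 * i) \<and> b (2 * i) \<le> b n"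
      using mono by auto
    then show "c n = c i \<and> b n = b i" using a by linarith
  qed (rule i)
  have "b i \<le> b (i - 1)" using mono[of "i - 1" i] i by auto
  then show False
    using no_b_drop[OF V] no_c_jump[OF V] jump by fastforce
qed

lemma dist_bound:
  assumes c2: "2 \<le> c 2" and V: "x \<in> V" "y \<in> V"
  shows "d x y < 2 ^ (2 * b 0 + 2)"
proof (rule ccontr)
  assume "\<not> ?thesis"
  then have big: "2 ^ (2 * b 0 + 2) \<le> d x y" by simp
  \<comment> \<open>Up to \<open>d x y\<close> this is nondecreasing, and every change of
    \<open>c\<close> or \<open>b\<close> raises it; its values lie between \<open>- b 0\<close> and
    \<open>b 0\<close>.\<close>
  define pot where "pot n = int (c n) - int (b n)" for n
  have mono: "pot l \<le> pot n" if "l \<le> n" "n \<le> d x y" for l n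
    using c_mono[OF V that] unfolding pot_def by linarith
  have "\<exists>i\<ge>2. i \<le> 2 ^ (r + 1) \<and> (c (i - 1) < c i \<or> b i < b (i - 1)) \<and> int r \<le> pot i + int (b 0)"
    if "2 ^ (r + 1) \<le> d x y" for r
    using that
  proof (induction r)
    case 0
    then have "0 < d x y" by auto
    then obtain n where "d x y = Suc n" by (cases "d x y") auto
    then have c1: "c 1 = 1" using d_succ[OF V, of n] c_one by blast
    obtain z where z: "z \<in> V" "d x z = 2" using d_between[OF V, of 2] 0 by auto
    then have "b 2 \<le> b 0" using b_le[OF V(1) z(1)] by simp
    then show ?case using c1 c2 by (intro exI[of _ 2]) (auto simp: pot_def)
  next
    case (Suc r)
    have "(2::nat) ^ (r + 1) \<le> 2 ^ (Suc r + 1)" by simp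
    then have "2 ^ (r + 1) \<le> d x y" using Suc.prems by (rule le_trans)
    then obtain i where i: "2 \<le> i" "i \<le> 2 ^ (r + 1)" "c (i - 1) < c i \<or> b i < b (i - 1)"
      "int r \<le> pot i + int (b 0)" using Suc.IH by blast
    have i2: "2 * i \<le> 2 ^ (Suc r + 1)" using i(2) by simp
    then have i3: "2 * i \<le> d x y" using Suc.prems by simp
    have "c i \<le> c (2 * i)" "b (2 * i) \<le> b i" using c_mono[OF V _ i3, of i] by auto
    then have p: "pot i < pot (2 * i)"
      using ivanov[OF i(1) V i3 i(3)] unfolding pot_def by linarith
    \<comment> \<open>\<open>ivanov\<close> only compares \<open>i\<close> with \<open>2 i\<close>;
      the least index of larger potential locates a change exactly between \<open>j - 1\<close> and
      \<open>j\<close>, so the induction can continue.\<close>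
    define j where "j = (LEAST j. i < j \<and> pot i < pot j)"
    have j: "i < j \<and> pot i < pot j" unfolding j_def
      by (rule LeastI[of _ "2 * i"]) (use p i in auto)
    have jle: "j \<le> 2 * i" unfolding j_def by (rule Least_le) (use p i in auto)
    have "\<not> (i < j - 1 \<and> pot i < pot (j - 1))"
      using not_less_Least[of "j - 1" "\<lambda>j. i < j \<and> pot i < pot j"] j unfolding j_def[symmetric] by simp
    then have "pot (j - 1) \<le> pot i" using j by (cases "i = j - 1") auto
    then have "pot (j - 1) < pot j" using j by simp
    then have "c (j - 1) < c j \<or> b j < b (j - 1)" unfolding pot_def by linarith
    moreover have "int (Suc r) \<le> pot j + int (b 0)" using j i by simp
    ultimately show ?case using j jle i i2 by (intro exI[of _ j]) auto
  qed
  from this[of "2 * b 0 + 1"] big obtain i where i: "i \<le> 2 ^ (2 * b 0 + 2)"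
    "int (2 * b 0 + 1) \<le> pot i + int (b 0)" by auto
  obtain z where z: "z \<in> V" "d x z = i" using d_between[OF V, of i] big i by auto
  have "c i \<le> b 0" using c_le[OF V(1) z(1)] z by simp
  then show False using i unfolding pot_def by linarith
qed

lemma card_V_bound:
  assumes "2 \<le> c 2"
  shows "card V \<le> (b 0 + 1) ^ (2 ^ (2 * b 0 + 2))"
proof -
  obtain x where x: "x \<in> V" using V_ne by blast
  have "{y\<in>V. d x y \<le> 2 ^ (2 * b 0 + 2)} = V"
    using dist_bound[OF assms x] by (auto intro: less_imp_le)
  then show ?thesis using card_ball[OF x, of "b 0" "2 ^ (2 * b 0 + 2)"] card_nb by simp
qed

end

section \<open>Spectra of graphs\<close>

text \<open>Gaussian elimination: an equation with a nonzero coefficient at \<open>u\<close>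
  eliminates \<open>u\<close>, lowering both counts by one. It will supply a dependence between
  eigenvectors and a vector with zero sum on every line.\<close>

lemma homogeneous_system:
  fixes M :: "'i \<Rightarrow> 'x \<Rightarrow> real"
  assumes "finite I" "finite X" "card I < card X"
  shows "\<exists>f. (\<exists>x\<in>X. f x \<noteq> 0) \<and> (\<forall>i\<in>I. (\<Sum>x\<in>X. M i x * f x) = 0)"
  using assms
proof (induction I arbitrary: X M rule: finite_induct)
  case empty
  then obtain x where "x \<in> X" by fastforce
  then show ?case by (intro exI[of _ "\<lambda>_. 1"]) auto
next
  case (insert i I)
  show ?case
  proof (cases "\<forall>x\<in>X. M i x = 0")
    case True
    from insert.IH[of X M] insert.prems insert.hyps
    obtain f where "\<exists>x\<in>X. f x \<noteq> 0" "\<forall>i\<in>I. (\<Sum>x\<in>X. M i x * f x) = 0" by auto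
    then show ?thesis using True by (intro exI[of _ f]) auto
  next
    case False
    then obtain u where u: "u \<in> X" "M i u \<noteq> 0" by blast
    define X' where "X' = X - {u}"
    have X': "X = insert u X'" "u \<notin> X'" "finite X'" using u insert.prems X'_def by auto
    have "card I < card X'" using insert X' by auto
    from insert.IH[OF X'(3) this, of "\<lambda>j x. M j x - M j u * M i x / M i u"]
    obtain f where f: "\<exists>x\<in>X'. f x \<noteq> 0"
      "\<forall>j\<in>I. (\<Sum>x\<in>X'. (M j x - M j u * M i x / M i u) * f x) = 0" by blast
    define F where "F x = (if x = u then - (\<Sum>x\<in>X'. M i x * f x) / M i u else f x)" for x
    have sumF: "(\<Sum>x\<in>X. M j x * F x) = (\<Sum>x\<in>X'. M j x * f x) - M j u * (\<Sum>x\<in>X'. M i x * f x) / M i u" for j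
    proof -
      have "(\<Sum>x\<in>X'. M j x * F x) = (\<Sum>x\<in>X'. M j x * f x)"
        using X' by (intro sum.cong) (auto simp: F_def)
      then show ?thesis using X' by (simp add: F_def)
    qed
    have "(\<Sum>x\<in>X. M j x * F x) = 0" if "j \<in> I" for j
    proof -
      have "(\<Sum>x\<in>X'. (M j x - M j u * M i x / M i u) * f x)
          = (\<Sum>x\<in>X'. M j x * f x) - M j u * (\<Sum>x\<in>X'. M i x * f x) / M i u"
        by (simp add: left_diff_distrib sum_subtractf sum_distrib_left sum_divide_distrib mult.assoc)
      then show ?thesis using f(2) that sumF by simp
    qed
    moreover have "(\<Sum>x\<in>X. M i x * F x) = 0" using sumF[of i] u by simp
    moreover have "\<exists>x\<in>X. F x \<noteq> 0" using f(1) X' by (auto simp: F_def)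
    ultimately show ?thesis by (intro exI[of _ F]) auto
  qed
qed

text \<open>First-order condition at a minimum. The test value \<open>- a * s\<close> is so small
  that \<open>2 + r * s\<close> stays positive.\<close>

lemma linear_coeff_zero:
  fixes a r :: real
  assumes "\<And>t. 2 * t * a - r * t\<^sup>2 \<ge> 0"
  shows "a = 0"
proof (rule ccontr)
  assume a: "a \<noteq> 0"
  define s where "s = 1 / (1 + \<bar>r\<bar>)"
  have s: "s > 0" "\<bar>r * s\<bar> < 1" by (auto simp: s_def abs_mult)
  have "2 * (- a * s) * a - r * (- a * s)\<^sup>2 = - (a\<^sup>2 * s) * (2 + r * s)"
    by (simp add: power2_eq_square algebra_simps)
  moreover have "a\<^sup>2 * s * (2 + r * s) > 0" using a s by (intro mult_pos_pos) auto
  ultimately show False using assms[of "- a * s"] by auto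
qed

section \<open>Quadratic form and smallest eigenvalue\<close>

context graph_metric
begin

definition adj_op :: "('a \<Rightarrow> real) \<Rightarrow> 'a \<Rightarrow> real" where
  "adj_op f x = (\<Sum>y\<in>nb x. f y)"

definition ip :: "('a \<Rightarrow> real) \<Rightarrow> ('a \<Rightarrow> real) \<Rightarrow> real" where
  "ip f g = (\<Sum>x\<in>V. f x * g x)"

abbreviation quad :: "('a \<Rightarrow> real) \<Rightarrow> real" where "quad f \<equiv> ip f (adj_op f)"

lemma adj_op_alt: "adj_op f x = (\<Sum>y\<in>V. if E x y then f y else 0)"
proof -
  have "nb x = {y\<in>V. E x y}" using nb_sub by auto
  then show ?thesis unfolding adj_op_def by (simp add: sum.inter_filter)
qed

lemma adj_op_add: "adj_op (\<lambda>x. f x + g x) x = adj_op f x + adj_op g x"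
  unfolding adj_op_def by (simp add: sum.distrib)

lemma adj_op_scale: "adj_op (\<lambda>x. r * f x) x = r * adj_op f x"
  unfolding adj_op_def by (simp add: sum_distrib_left)

lemma adj_op_cong: "(\<And>x. x \<in> V \<Longrightarrow> f x = g x) \<Longrightarrow> adj_op f y = adj_op g y"
  unfolding adj_op_def using nb_sub by (intro sum.cong) auto

lemma ip_commute: "ip f g = ip g f"
  unfolding ip_def by (simp add: mult.commute)

lemma ip_adj_op: "ip f (adj_op g) = ip (adj_op f) g"
proof -
  have "ip f (adj_op g) = (\<Sum>x\<in>V. \<Sum>y\<in>V. if E x y then f x * g y else 0)"
    unfolding ip_def adj_op_alt by (auto intro!: sum.cong simp: sum_distrib_left)
  also have "\<dots> = (\<Sum>y\<in>V. \<Sum>x\<in>V. if E x y then f x * g y else 0)" by (rule sum.swap)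
  also have "\<dots> = ip (adj_op f) g"
    unfolding ip_def adj_op_alt
    by (auto intro!: sum.cong simp: sum_distrib_right E_commute)
  finally show ?thesis .
qed

lemma ip_nonneg: "0 \<le> ip f f"
  unfolding ip_def by (intro sum_nonneg) auto

lemma ip_pos: "x \<in> V \<Longrightarrow> f x \<noteq> 0 \<Longrightarrow> 0 < ip f f"
  unfolding ip_def by (intro sum_pos2[of V x]) (auto simp: zero_less_mult_iff)

lemma ip_add_single:
  "x \<in> V \<Longrightarrow> ip (\<lambda>y. f y + t * of_bool (y = x)) (\<lambda>y. f y + t * of_bool (y = x)) = ip f f + 2 * t * f x + t\<^sup>2"
proof -
  assume x: "x \<in> V"
  have "ip (\<lambda>y. f y + t * of_bool (y = x)) (\<lambda>y. f y + t * of_bool (y = x))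
      = (\<Sum>y\<in>V. f y * f y + (if y = x then 2 * t * f y + t\<^sup>2 else 0))"
    unfolding ip_def by (intro sum.cong) (auto simp: power2_eq_square algebra_simps)
  also have "\<dots> = ip f f + (2 * t * f x + t\<^sup>2)"
    using x by (simp add: sum.distrib ip_def)
  finally show ?thesis by simp
qed

lemma quad_add_single:
  "x \<in> V \<Longrightarrow> quad (\<lambda>y. f y + t * of_bool (y = x)) = quad f + 2 * t * adj_op f x"
proof -
  assume x: "x \<in> V"
  let ?e = "\<lambda>y. of_bool (y = x) :: real"
  have e: "ip ?e g = g x" for g
  proof -
    have "ip ?e g = (\<Sum>y\<in>V. if y = x then g y else 0)"
      unfolding ip_def by (intro sum.cong) auto
    then show ?thesis using x by simp
  qed
  have add: "ip (\<lambda>y. f y + t * ?e y) g = ip f g + t * ip ?e g" for g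
    unfolding ip_def sum_distrib_left sum.distrib[symmetric]
    by (intro sum.cong) (auto simp: algebra_simps)
  \<comment> \<open>There are no loops, so no term in \<open>t\<^sup>2\<close> arises.\<close>
  have "adj_op ?e x = 0" unfolding adj_op_def by (intro sum.neutral) auto
  then have "quad (\<lambda>y. f y + t * ?e y) = ip f (adj_op (\<lambda>y. f y + t * ?e y)) + t * adj_op f x"
    by (simp add: add e adj_op_add adj_op_scale)
  also have "ip f (adj_op (\<lambda>y. f y + t * ?e y)) = ip (\<lambda>y. f y + t * ?e y) (adj_op f)"
    by (subst ip_adj_op) (rule ip_commute)
  also have "\<dots> = quad f + t * adj_op f x" by (simp add: add e)
  finally show ?thesis by simp
qed

lemma adj_eigenvalue_iff:
  "adj_eigenvalue V E \<theta> \<longleftrightarrow> (\<exists>f. (\<exists>x\<in>V. f x \<noteq> 0) \<and> (\<forall>x\<in>V. adj_op f x = \<theta> * f x))"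
proof -
  have "{y\<in>V. E x y} = nb x" for x using nb_sub by auto
  then show ?thesis unfolding adj_eigenvalue_def adj_op_def by simp
qed

lemma ip_eigenvector: "\<forall>x\<in>V. adj_op f x = \<theta> * f x \<Longrightarrow> ip g (adj_op f) = \<theta> * ip g f"
  unfolding ip_def by (simp add: sum_distrib_left algebra_simps)

text \<open>Makes the \<open>Min\<close> in \<open>smallest_eigenvalue\<close> meaningful.
  Eigenvectors for distinct eigenvalues are orthogonal; with more than \<open>card V\<close> of
  them, pairing a linear dependence with one that occurs in it gives a zero norm.\<close>

lemma finite_eigenvalues: "finite {\<theta>. adj_eigenvalue V E \<theta>}"
proof (rule ccontr)
  assume "infinite {\<theta>. adj_eigenvalue V E \<theta>}"
  then obtain T where T: "T \<subseteq> {\<theta>. adj_eigenvalue V E \<theta>}" "finite T" "card T = card V + 1"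
    using infinite_arbitrarily_large by blast
  then have "\<forall>\<theta>\<in>T. \<exists>f. (\<exists>x\<in>V. f x \<noteq> 0) \<and> (\<forall>x\<in>V. adj_op f x = \<theta> * f x)"
    using adj_eigenvalue_iff by blast
  then obtain F where F: "\<And>\<theta>. \<theta> \<in> T \<Longrightarrow> (\<exists>x\<in>V. F \<theta> x \<noteq> 0) \<and> (\<forall>x\<in>V. adj_op (F \<theta>) x = \<theta> * F \<theta> x)"
    by metis
  have orth: "ip (F \<theta>) (F \<eta>) = 0" if "\<theta> \<in> T" "\<eta> \<in> T" "\<theta> \<noteq> \<eta>" for \<theta> \<eta>
  proof -
    have "\<eta> * ip (F \<theta>) (F \<eta>) = ip (F \<theta>) (adj_op (F \<eta>))" using ip_eigenvector F that by metis
    also have "\<dots> = ip (F \<eta>) (adj_op (F \<theta>))"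
      by (subst ip_adj_op) (rule ip_commute)
    also have "\<dots> = \<theta> * ip (F \<theta>) (F \<eta>)" using ip_eigenvector F that ip_commute by metis
    finally show ?thesis using that by simp
  qed
  from homogeneous_system[OF finV T(2), of "\<lambda>x \<theta>. F \<theta> x"] T(3)
  obtain a where a: "\<exists>\<theta>\<in>T. a \<theta> \<noteq> 0" "\<forall>x\<in>V. (\<Sum>\<theta>\<in>T. F \<theta> x * a \<theta>) = 0" by auto
  then obtain \<theta> where \<theta>: "\<theta> \<in> T" "a \<theta> \<noteq> 0" by blast
  have "0 = (\<Sum>x\<in>V. F \<theta> x * (\<Sum>\<eta>\<in>T. F \<eta> x * a \<eta>))" using a(2) by simp
  also have "\<dots> = (\<Sum>x\<in>V. \<Sum>\<eta>\<in>T. a \<eta> * (F \<theta> x * F \<eta> x))"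
    by (simp add: sum_distrib_left algebra_simps)
  also have "\<dots> = (\<Sum>\<eta>\<in>T. a \<eta> * ip (F \<theta>) (F \<eta>))"
    unfolding ip_def sum_distrib_left by (rule sum.swap)
  also have "\<dots> = (\<Sum>\<eta>\<in>T. if \<eta> = \<theta> then a \<theta> * ip (F \<theta>) (F \<theta>) else 0)"
    using orth \<theta> by (intro sum.cong) auto
  also have "\<dots> = a \<theta> * ip (F \<theta>) (F \<theta>)" using T(2) \<theta> by simp
  finally show False using \<theta> F[OF \<theta>(1)] ip_pos by fastforce
qed

text \<open>A minimiser on the unit sphere is an eigenvector: perturbing it along each coordinate
  vector gives the eigenvalue equation at that vertex.\<close>

lemma ex_rayleigh_min: "\<exists>\<theta>. adj_eigenvalue V E \<theta> \<and> (\<forall>f. \<theta> * ip f f \<le> quad f)"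
proof -
  \<comment> \<open>Pinning the functions to \<open>0\<close> outside \<open>V\<close> makes the
    cube, and with it the unit sphere \<open>S\<close>, compact in the product topology.\<close>
  define K :: "('a \<Rightarrow> real) set" where "K = PiE UNIV (\<lambda>x. if x \<in> V then {-1..1} else {0})"
  have "compactin (product_topology (\<lambda>_. euclidean) UNIV) K"
    unfolding K_def by (subst compactin_PiE) auto
  then have cK: "compact K" by (simp add: euclidean_product_topology)
  have cont: "continuous_on UNIV (\<lambda>f. f x)" for x :: 'a by (rule continuous_on_product_coordinates)
  have cip: "continuous_on A (\<lambda>f. ip f f)" for A
    unfolding ip_def by (intro continuous_intros continuous_on_subset[OF cont]) auto
  have cq: "continuous_on A quad" for A
    unfolding ip_def adj_op_def by (intro continuous_intros continuous_on_subset[OF cont]) auto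
  define S where "S = K \<inter> {f. ip f f = 1}"
  have "closed {f. ip f f = 1}"
    using continuous_closed_preimage[OF cip closed_UNIV, of "{1}"] by (simp add: vimage_def)
  then have cS: "compact S" unfolding S_def by (rule compact_Int_closed[OF cK])
  have norm: "\<exists>h\<in>S. quad g = ip g g * quad h" if g: "0 < ip g g" for g
  proof -
    define h where "h x = (if x \<in> V then g x / sqrt (ip g g) else 0)" for x
    have le: "(g x)\<^sup>2 \<le> ip g g" if "x \<in> V" for x
      unfolding ip_def power2_eq_square using that by (intro member_le_sum) auto
    have h1: "\<bar>h x\<bar> \<le> 1" for x
      using le[of x] real_le_rsqrt[of "\<bar>g x\<bar>" "ip g g"] g by (auto simp: h_def)
    have "h x \<in> (if x \<in> V then {-1..1} else {0})" for x
    proof (cases "x \<in> V")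
      case True
      then show ?thesis using h1[of x] by (simp add: abs_le_iff)
    qed (simp add: h_def)
    then have "h \<in> K" unfolding K_def by (simp add: PiE_iff)
    moreover have "ip h h = 1"
    proof -
      have "ip h h = (\<Sum>x\<in>V. g x * g x / ip g g)"
        unfolding ip_def[of h] using g by (intro sum.cong) (auto simp: h_def)
      also have "\<dots> = 1" using g by (simp add: sum_divide_distrib[symmetric] ip_def)
      finally show ?thesis .
    qed
    moreover have "quad h = quad g / ip g g"
    proof -
      have "adj_op h x = adj_op g x / sqrt (ip g g)" for x
        unfolding adj_op_def sum_divide_distrib using nb_sub by (intro sum.cong) (auto simp: h_def)
      then have "quad h = (\<Sum>x\<in>V. g x * adj_op g x / ip g g)"
        unfolding ip_def[of h] using g by (intro sum.cong) (auto simp: h_def)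
      then show ?thesis by (simp add: sum_divide_distrib[symmetric] ip_def)
    qed
    ultimately show ?thesis using g unfolding S_def by (intro bexI[of _ h]) auto
  qed
  obtain x0 where x0: "x0 \<in> V" using V_ne by blast
  have "S \<noteq> {}" using norm[OF ip_pos[OF x0, of "\<lambda>_. 1"]] by auto
  from continuous_attains_inf[OF cS this cq] obtain f where f: "f \<in> S" "\<forall>h\<in>S. quad f \<le> quad h" by blast
  define \<theta> where "\<theta> = quad f"
  have ff: "ip f f = 1" using f by (auto simp: S_def)
  have min: "\<theta> * ip g g \<le> quad g" for g
  proof (cases "ip g g = 0")
    case True
    then have "g x = 0" if "x \<in> V" for x using ip_pos[OF that, of g] by force
    then have "quad g = 0" unfolding ip_def by simp
    then show ?thesis using True by simp
  next
    case False
    then have g: "0 < ip g g" using ip_nonneg[of g] by simp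
    then obtain h where "h \<in> S" "quad g = ip g g * quad h" using norm by blast
    then show ?thesis using f g by (simp add: \<theta>_def mult.commute)
  qed
  have "adj_op f x = \<theta> * f x" if x: "x \<in> V" for x
  proof -
    have "2 * t * (adj_op f x - \<theta> * f x) - \<theta> * t\<^sup>2 \<ge> 0" for t
      using min[of "\<lambda>y. f y + t * of_bool (y = x)"] ff
      unfolding quad_add_single[OF x] ip_add_single[OF x] by (simp add: \<theta>_def algebra_simps)
    then show ?thesis using linear_coeff_zero by fastforce
  qed
  moreover have "\<exists>x\<in>V. f x \<noteq> 0"
  proof (rule ccontr)
    assume "\<not> ?thesis"
    then have "ip f f = 0" unfolding ip_def by simp
    then show False using ff by simp
  qed
  ultimately show ?thesis using min adj_eigenvalue_iff by blast
qed

lemma smallest_eigenvalue_props: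
  shows "adj_eigenvalue V E (smallest_eigenvalue V E)"
    and "smallest_eigenvalue V E * ip f f \<le> quad f"
    and "adj_eigenvalue V E \<eta> \<Longrightarrow> smallest_eigenvalue V E \<le> \<eta>"
proof -
  obtain \<theta> where \<theta>: "adj_eigenvalue V E \<theta>" "\<And>f. \<theta> * ip f f \<le> quad f"
    using ex_rayleigh_min by blast
  have ge: "\<theta> \<le> \<eta>" if e: "adj_eigenvalue V E \<eta>" for \<eta>
  proof -
    obtain f x where f: "x \<in> V" "f x \<noteq> 0" "\<forall>x\<in>V. adj_op f x = \<eta> * f x"
      using e adj_eigenvalue_iff by blast
    have "\<theta> * ip f f \<le> \<eta> * ip f f" using \<theta>(2)[of f] ip_eigenvector[OF f(3)] by simp
    then show ?thesis using ip_pos[of x f] f by simp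
  qed
  have "smallest_eigenvalue V E = \<theta>"
    unfolding smallest_eigenvalue_def using finite_eigenvalues \<theta> ge by (intro Min_eqI) auto
  then show "adj_eigenvalue V E (smallest_eigenvalue V E)"
    "smallest_eigenvalue V E * ip f f \<le> quad f"
    "adj_eigenvalue V E \<eta> \<Longrightarrow> smallest_eigenvalue V E \<le> \<eta>" using \<theta> ge by auto
qed

end

section \<open>Powers of \<open>k I - A\<close> and Delsarte's clique bound\<close>

context drg
begin

text \<open>The matrix \<open>k I - A\<close>. It is positive semidefinite, hence so are all its
  powers, odd ones included.\<close>

definition shift :: "('a \<Rightarrow> real) \<Rightarrow> 'a \<Rightarrow> real" where
  "shift f x = real (b 0) * f x - adj_op f x"

text \<open>\<open>ker n (d x y)\<close> is the \<open>(x, y)\<close> entry of the matrix \<open>(k I - A)\<^sup>n\<close>.\<close>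

primrec ker :: "nat \<Rightarrow> nat \<Rightarrow> real" where
  "ker 0 = (\<lambda>i. of_bool (i = 0))"
| "ker (Suc n) = (\<lambda>i. b 0 * ker n i
    - (c i * ker n (i - 1) + b i * ker n (i + 1) + (real (b 0) - c i - b i) * ker n i))"

text \<open>This recurrence is why the entries of the powers depend on the distance only. At
  distance \<open>0\<close> the truncated \<open>d x y - 1\<close> is harmless, its coefficient
  being \<open>c 0 = 0\<close>.\<close>

lemma sum_nb_dist:
  fixes h :: "nat \<Rightarrow> real"
  assumes V: "x \<in> V" "y \<in> V"
  shows "(\<Sum>z\<in>nb y. h (d x z)) = c (d x y) * h (d x y - 1) + b (d x y) * h (d x y + 1)
    + (real (b 0) - c (d x y) - b (d x y)) * h (d x y)"
proof -
  define N where "N = nb y - (Cs x y \<union> Bs x y)"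
  have disj: "Cs x y \<inter> Bs x y = {}" by auto
  have nb_eq: "nb y = N \<union> (Cs x y \<union> Bs x y)" "N \<inter> (Cs x y \<union> Bs x y) = {}" "finite N"
    unfolding N_def by auto
  have "card (nb y) = card N + (card (Cs x y) + card (Bs x y))"
    by (subst nb_eq(1)) (use nb_eq disj in \<open>simp add: card_Un_disjoint\<close>)
  then have cN: "real (card N) = real (b 0) - c (d x y) - b (d x y)"
    using card_nb[OF V(2)] card_c[OF V] card_b[OF V] by simp
  have "h (d x z) = h (d x y)" if "z \<in> N" for z
  proof -
    have yz: "E y z" using that N_def by auto
    then have "d x z = d x y"
      using d_step[OF V(1) yz] d_step2[OF V(1) yz] that unfolding N_def by fastforce
    then show ?thesis by simp
  qed
  then have sN: "(\<Sum>z\<in>N. h (d x z)) = card N * h (d x y)" by simp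
  have sC: "(\<Sum>z\<in>Cs x y. h (d x z)) = card (Cs x y) * h (d x y - 1)"
  proof -
    have "(\<Sum>z\<in>Cs x y. h (d x z)) = (\<Sum>z\<in>Cs x y. h (d x y - 1))"
    proof (rule sum.cong)
      fix z assume "z \<in> Cs x y"
      then have "d x y = d x z + 1" by auto
      then show "h (d x z) = h (d x y - 1)" by simp
    qed simp
    then show ?thesis by simp
  qed
  have sB: "(\<Sum>z\<in>Bs x y. h (d x z)) = card (Bs x y) * h (d x y + 1)" by simp
  have "(\<Sum>z\<in>nb y. h (d x z))
      = (\<Sum>z\<in>N. h (d x z)) + ((\<Sum>z\<in>Cs x y. h (d x z)) + (\<Sum>z\<in>Bs x y. h (d x z)))"
    by (subst nb_eq(1)) (use nb_eq disj in \<open>simp add: sum.union_disjoint\<close>)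
  then show ?thesis using sN sC sB cN card_c[OF V] card_b[OF V] by simp
qed

lemma shift_power: "x \<in> V \<Longrightarrow> (shift ^^ n) f x = (\<Sum>y\<in>V. ker n (d x y) * f y)"
proof (induction n arbitrary: x)
  case 0
  have "(\<Sum>y\<in>V. ker 0 (d x y) * f y) = (\<Sum>y\<in>V. if y = x then f y else 0)"
    using d_zero[OF 0] by (intro sum.cong) auto
  then show ?case using 0 by simp
next
  case (Suc n)
  have "(\<Sum>z\<in>nb x. (shift ^^ n) f z) = (\<Sum>z\<in>nb x. \<Sum>y\<in>V. ker n (d y z) * f y)"
  proof (rule sum.cong)
    fix z assume "z \<in> nb x"
    then have z: "z \<in> V" using nb_sub by blast
    show "(shift ^^ n) f z = (\<Sum>y\<in>V. ker n (d y z) * f y)"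
      unfolding Suc.IH[OF z] using d_sym z by (intro sum.cong) auto
  qed simp
  also have "\<dots> = (\<Sum>y\<in>V. (\<Sum>z\<in>nb x. ker n (d y z)) * f y)"
    unfolding sum_distrib_right by (rule sum.swap)
  finally have "(shift ^^ Suc n) f x
      = (\<Sum>y\<in>V. (b 0 * ker n (d x y) - (\<Sum>z\<in>nb x. ker n (d y z))) * f y)"
    using Suc.IH[OF Suc.prems]
    by (simp add: shift_def[of "(shift ^^ n) f" x] adj_op_def sum_distrib_left sum_subtractf
        left_diff_distrib mult.assoc)
  also have "\<dots> = (\<Sum>y\<in>V. ker (Suc n) (d x y) * f y)"
    using sum_nb_dist[OF _ Suc.prems] d_sym[OF Suc.prems] by (intro sum.cong) auto
  finally show ?case .
qed

lemma ip_shift: "ip (shift f) g = ip f (shift g)"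
proof -
  have "ip (shift f) g = b 0 * ip f g - ip (adj_op f) g"
    unfolding ip_def shift_def by (simp add: left_diff_distrib sum_subtractf sum_distrib_left mult.assoc)
  also have "\<dots> = b 0 * ip f g - ip f (adj_op g)" by (simp add: ip_adj_op)
  also have "\<dots> = ip f (shift g)"
    unfolding ip_def shift_def by (simp add: right_diff_distrib sum_subtractf sum_distrib_left ac_simps)
  finally show ?thesis .
qed

text \<open>On each edge the product of the values is at most half the sum of their squares, and
  every vertex lies on \<open>b 0\<close> edges.\<close>

lemma shift_nonneg: "0 \<le> ip f (shift f)"
proof -
  have nb1: "(\<Sum>y\<in>V. if E x y then r else (0::real)) = b 0 * r" if "x \<in> V" for x and r :: real
    using adj_op_alt[of "\<lambda>_. r" x] card_nb[OF that] by (simp add: adj_op_def)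
  have "quad f = (\<Sum>x\<in>V. \<Sum>y\<in>V. if E x y then f x * f y else 0)"
    unfolding ip_def adj_op_alt by (auto intro!: sum.cong simp: sum_distrib_left)
  also have "\<dots> \<le> (\<Sum>x\<in>V. \<Sum>y\<in>V. (if E x y then (f x)\<^sup>2 / 2 else 0) + (if E y x then (f y)\<^sup>2 / 2 else 0))"
  proof (intro sum_mono)
    fix x y
    have "0 \<le> (f x - f y)\<^sup>2" by simp
    then have "f x * f y \<le> (f x)\<^sup>2 / 2 + (f y)\<^sup>2 / 2" by (simp add: power2_diff)
    then show "(if E x y then f x * f y else 0)
        \<le> (if E x y then (f x)\<^sup>2 / 2 else 0) + (if E y x then (f y)\<^sup>2 / 2 else 0)"
      using E_commute by auto
  qed
  also have "\<dots> = (\<Sum>x\<in>V. \<Sum>y\<in>V. if E x y then (f x)\<^sup>2 / 2 else 0)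
      + (\<Sum>y\<in>V. \<Sum>x\<in>V. if E y x then (f y)\<^sup>2 / 2 else 0)"
    unfolding sum.distrib by (intro arg_cong2[where f = "(+)"] refl sum.swap)
  also have "\<dots> = b 0 * ip f f"
  proof -
    have "(\<Sum>x\<in>V. \<Sum>y\<in>V. if E x y then (f x)\<^sup>2 / 2 else 0) = b 0 * ip f f / 2"
      unfolding ip_def sum_distrib_left sum_divide_distrib
    proof (intro sum.cong refl)
      fix x assume "x \<in> V"
      then have "(\<Sum>y\<in>V. if E x y then (f x)\<^sup>2 / 2 else 0) = b 0 * ((f x)\<^sup>2 / 2)" by (rule nb1)
      then show "(\<Sum>y\<in>V. if E x y then (f x)\<^sup>2 / 2 else 0) = b 0 * (f x * f x) / 2"
        by (metis power2_eq_square times_divide_eq_right)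
    qed
    then show ?thesis by simp
  qed
  finally have "quad f \<le> b 0 * ip f f" .
  moreover have "ip f (shift f) = b 0 * ip f f - quad f"
    unfolding ip_def shift_def by (simp add: right_diff_distrib sum_subtractf sum_distrib_left ac_simps)
  ultimately show ?thesis by simp
qed

lemma ip_shift_power: "ip ((shift ^^ n) f) g = ip f ((shift ^^ n) g)"
proof (induction n arbitrary: g)
  case (Suc n)
  have "(shift ^^ Suc n) g = (shift ^^ n) (shift g)" by (simp add: funpow_swap1)
  then show ?case using Suc.IH[of "shift g"] ip_shift[of "(shift ^^ n) f" g] by simp
qed simp

text \<open>Moving half of the power to the left factor leaves a squared norm for even
  \<open>n\<close>, and the form of \<open>k I - A\<close> itself for odd \<open>n\<close>.\<close>

lemma shift_power_nonneg: "0 \<le> ip f ((shift ^^ n) f)"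
proof (cases "even n")
  case True
  then obtain l where "n = l + l" by (metis evenE mult_2)
  then show ?thesis
    using ip_nonneg[of "(shift ^^ l) f"] by (simp add: funpow_add ip_shift_power)
next
  case False
  then obtain l where "n = 2 * l + 1" using oddE by blast
  then have "n = l + Suc l" by simp
  then have "(shift ^^ n) f = (shift ^^ l) (shift ((shift ^^ l) f))"
    by (metis comp_apply funpow.simps(2) funpow_add)
  then show ?thesis
    using shift_nonneg[of "(shift ^^ l) f"] by (simp add: ip_shift_power)
qed

lemma ip_indicator_kernel:
  assumes "A \<subseteq> V"
  shows "ip (\<lambda>x. s x * of_bool (x \<in> A)) ((shift ^^ n) (\<lambda>x. s x * of_bool (x \<in> A)))
    = (\<Sum>x\<in>A. \<Sum>y\<in>A. s x * s y * ker n (d x y))"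
proof -
  have restr: "(\<Sum>y\<in>V. h y * (s y * of_bool (y \<in> A))) = (\<Sum>y\<in>A. h y * s y)" for h
    using assms by (intro sum.mono_neutral_cong_right) auto
  have "ip (\<lambda>x. s x * of_bool (x \<in> A)) ((shift ^^ n) (\<lambda>x. s x * of_bool (x \<in> A)))
      = (\<Sum>x\<in>V. (\<Sum>y\<in>A. ker n (d x y) * s y) * (s x * of_bool (x \<in> A)))"
    unfolding ip_def by (intro sum.cong) (simp_all add: shift_power restr)
  also have "\<dots> = (\<Sum>x\<in>A. (\<Sum>y\<in>A. ker n (d x y) * s y) * s x)" by (rule restr)
  finally show ?thesis by (simp add: sum_distrib_right sum_distrib_left ac_simps)
qed

text \<open>The diagonal of the power is constant, so testing it with the sum and the difference of
  two unit vectors suffices.\<close>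

lemma ker_bound:
  assumes V: "x \<in> V" "y \<in> V"
  shows "\<bar>ker n (d x y)\<bar> \<le> ker n 0"
proof (cases "x = y")
  case True
  have "{x} \<subseteq> V" using V by simp
  from shift_power_nonneg[of "\<lambda>z. 1 * of_bool (z \<in> {x})" n, unfolded ip_indicator_kernel[OF this]]
  have "0 \<le> ker n 0" by simp
  then show ?thesis using True by simp
next
  case False
  have "0 \<le> 2 * ker n 0 + 2 * r * ker n (d x y)" if r: "r * r = 1" for r :: real
  proof -
    define s where "s z = (if z = x then 1 else r)" for z
    have "{x, y} \<subseteq> V" using V by simp
    from shift_power_nonneg[of "\<lambda>z. s z * of_bool (z \<in> {x, y})" n, unfolded ip_indicator_kernel[OF this]]
    have "0 \<le> (\<Sum>u\<in>{x,y}. \<Sum>v\<in>{x,y}. s u * s v * ker n (d u v))" .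
    moreover have "r * (r * u) = u" for u using r by (metis mult.assoc mult_1)
    ultimately show ?thesis using False d_sym[OF V] by (simp add: s_def algebra_simps)
  qed
  from this[of 1] this[of "-1"] show ?thesis by auto
qed

text \<open>Delsarte's bound. Testing the powers of \<open>T = k I - A\<close> with the indicator of
  \<open>C\<close> gives \<open>ker n 0 + q * ker n 1 \<ge> 0\<close>, so the diagonal of
  \<open>T^n\<close> is at most \<open>(k + k / q)^n\<close>. The diagonal dominates all entries, so
  the eigenvalue \<open>k - \<theta>\<close> of \<open>T\<close> cannot exceed
  \<open>k + k / q\<close>.\<close>

lemma clique_bound:
  fixes q :: nat and \<theta> :: real
  assumes C: "is_clique V E C" "card C = q + 1" and q: "0 < q" and ev: "adj_eigenvalue V E \<theta>"
  shows "q * (- \<theta>) \<le> b 0"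
proof (rule ccontr)
  assume neg: "\<not> ?thesis"
  have CV: "C \<subseteq> V" using C unfolding is_clique_def by blast
  then have fC: "finite C" using finite_subset finV by metis
  define k where "k = real (b 0)"
  obtain x0 where x0: "x0 \<in> C" using C by fastforce
  have "0 < card (C - {x0})" using C x0 q fC by simp
  then obtain y0 where y0: "y0 \<in> C" "y0 \<noteq> x0" by (metis Diff_iff card_gt_0_iff ex_in_conv singletonI)
  then have "y0 \<in> nb x0" using C x0 unfolding is_clique_def by auto
  then have kpos: "0 < k" using card_nb[of x0] x0 CV card_gt_0_iff[of "nb x0"] by (auto simp: k_def)
  have one: "0 \<le> ker n 0 + q * ker n 1" for n
  proof -
    have "0 \<le> (\<Sum>x\<in>C. \<Sum>y\<in>C. ker n (d x y))"
      using shift_power_nonneg[of "\<lambda>x. 1 * of_bool (x \<in> C)" n]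
      unfolding ip_indicator_kernel[OF CV] by simp
    also have "\<dots> = (\<Sum>x\<in>C. ker n 0 + q * ker n 1)"
    proof (intro sum.cong refl)
      fix x assume x: "x \<in> C"
      have "(\<Sum>y\<in>C - {x}. ker n (d x y)) = (\<Sum>y\<in>C - {x}. ker n 1)"
        using C x d_edge unfolding is_clique_def by (intro sum.cong) auto
      then show "(\<Sum>y\<in>C. ker n (d x y)) = ker n 0 + q * ker n 1"
        using x fC C by (simp add: sum.remove[of C x])
    qed
    also have "\<dots> = (q + 1) * (ker n 0 + q * ker n 1)" using C by simp
    finally show ?thesis by (simp add: zero_le_mult_iff)
  qed
  have ker0: "ker n 0 \<le> (k + k / q) ^ n" for n
  proof (induction n)
    case (Suc n)
    have "- ker n 1 \<le> ker n 0 / q" using one[of n] q by (simp add: field_simps)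
    then have "- (k * ker n 1) \<le> k * (ker n 0 / q)" using kpos
      by (metis mult_le_cancel_left_pos mult_minus_right)
    \<comment> \<open>At distance \<open>0\<close> the recurrence for \<open>ker\<close> reduces to
      \<open>k * ker n 0 - k * ker n 1\<close>.\<close>
    then have "ker (Suc n) 0 \<le> (k + k / q) * ker n 0" by (simp add: k_def algebra_simps)
    also have "\<dots> \<le> (k + k / q) * (k + k / q) ^ n" using Suc kpos by (intro mult_left_mono) auto
    finally show ?case by simp
  qed simp
  obtain f x where f: "x \<in> V" "f x \<noteq> 0" "\<forall>x\<in>V. adj_op f x = \<theta> * f x"
    using ev adj_eigenvalue_iff by blast
  have pow: "u \<in> V \<Longrightarrow> (shift ^^ n) f u = (k - \<theta>) ^ n * f u" for n u
  proof (induction n arbitrary: u)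
    case (Suc n)
    have "adj_op ((shift ^^ n) f) u = adj_op (\<lambda>u. (k - \<theta>) ^ n * f u) u"
      using Suc.IH by (intro adj_op_cong)
    then have "adj_op ((shift ^^ n) f) u = (k - \<theta>) ^ n * (\<theta> * f u)"
      using f Suc.prems by (simp add: adj_op_scale)
    then show ?case
      using Suc.IH[OF Suc.prems] by (simp add: shift_def[of "(shift ^^ n) f" u] k_def algebra_simps)
  qed simp
  define S where "S = (\<Sum>y\<in>V. \<bar>f y\<bar>)"
  have est: "\<bar>(k - \<theta>) ^ n * f x\<bar> \<le> (k + k / q) ^ n * S" for n
  proof -
    have "\<bar>(k - \<theta>) ^ n * f x\<bar> \<le> (\<Sum>y\<in>V. \<bar>ker n (d x y) * f y\<bar>)"
      using pow[OF f(1)] shift_power[OF f(1)] sum_abs by metis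
    also have "\<dots> \<le> (\<Sum>y\<in>V. (k + k / q) ^ n * \<bar>f y\<bar>)"
      using ker_bound[OF f(1)] ker0 by (intro sum_mono) (auto simp: abs_mult intro!: mult_right_mono intro: order_trans)
    finally show ?thesis by (simp add: S_def sum_distrib_left)
  qed
  have big: "k + k / q < k - \<theta>" using neg q by (simp add: k_def field_simps)
  have pos: "0 < k + k / q" using kpos by (simp add: add_pos_nonneg)
  define r where "r = (k - \<theta>) / (k + k / q)"
  have r1: "1 < r" using big pos by (simp add: r_def)
  obtain n where n: "S / \<bar>f x\<bar> < r ^ n" using real_arch_pow[OF r1] by blast
  have "S < r ^ n * \<bar>f x\<bar>" using n f by (simp add: field_simps)
  then have "(k + k / q) ^ n * S < (k + k / q) ^ n * (r ^ n * \<bar>f x\<bar>)" using pos by simp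
  also have "\<dots> = (k - \<theta>) ^ n * \<bar>f x\<bar>"
    using pos by (simp add: r_def power_divide)
  also have "\<dots> = \<bar>(k - \<theta>) ^ n * f x\<bar>" using big pos by (simp add: abs_mult)
  finally show False using est[of n] by simp
qed

end

section \<open>Forbidden subgraphs and large local cliques\<close>

definition ramsey_bound :: "('a \<Rightarrow> 'a \<Rightarrow> bool) \<Rightarrow> nat \<Rightarrow> nat \<Rightarrow> nat \<Rightarrow> bool" where
  "ramsey_bound E p q r \<longleftrightarrow> (\<forall>X. finite X \<and> r \<le> card X \<longrightarrow>
     (\<exists>R\<subseteq>X. card R = p \<and> (\<forall>x\<in>R. \<forall>y\<in>R. x \<noteq> y \<longrightarrow> E x y) \<or>
            card R = q \<and> (\<forall>x\<in>R. \<forall>y\<in>R. x \<noteq> y \<longrightarrow> \<not> E x y)))"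

text \<open>\<open>r\<close> is chosen before the relation because it enters a bound valid for all
  graphs at once.\<close>

lemma ex_ramsey_bound: "\<exists>r. \<forall>E :: 'a \<Rightarrow> 'a \<Rightarrow> bool. symp E \<longrightarrow> ramsey_bound E p q r"
proof -
  obtain r where r: "\<forall>(V::'a set) (E::'a set set). finite V \<and> card V \<ge> r \<longrightarrow>
    (\<exists>R \<subseteq> V. card R = p \<and> clique R E \<or> card R = q \<and> indep R E)"
    using ramsey2[of p q] by blast
  have "ramsey_bound E p q r" if "symp E" for E :: "'a \<Rightarrow> 'a \<Rightarrow> bool"
  proof -
    have eq: "{x, y} \<in> {{u, v} | u v. E u v} \<longleftrightarrow> E x y" for x y
      using that by (auto simp: doubleton_eq_iff dest: sympD)
    show ?thesis unfolding ramsey_bound_def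
    proof (intro allI impI)
      fix X :: "'a set" assume "finite X \<and> r \<le> card X"
      with r[rule_format, of X "{{u, v} | u v. E u v}"]
      obtain R where "R \<subseteq> X" "card R = p \<and> clique R {{u, v} | u v. E u v} \<or>
         card R = q \<and> indep R {{u, v} | u v. E u v}" by blast
      then show "\<exists>R\<subseteq>X. card R = p \<and> (\<forall>x\<in>R. \<forall>y\<in>R. x \<noteq> y \<longrightarrow> E x y) \<or>
            card R = q \<and> (\<forall>x\<in>R. \<forall>y\<in>R. x \<noteq> y \<longrightarrow> \<not> E x y)"
        unfolding clique_def indep_def eq by (intro exI[of _ R]) blast
    qed
  qed
  then show ?thesis by blast
qed

lemma ex_subset_card: "n \<le> card S \<Longrightarrow> \<exists>T. T \<subseteq> S \<and> card T = n"
  by (metis obtain_subset_with_card_n)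

lemma ramsey_boundE:
  assumes "ramsey_bound E p q r" "finite X" "r \<le> card X"
  obtains (clique) R where "R \<subseteq> X" "card R = p" "\<And>x y. x \<in> R \<Longrightarrow> y \<in> R \<Longrightarrow> x \<noteq> y \<Longrightarrow> E x y"
    | (coclique) R where "R \<subseteq> X" "card R = q" "\<And>x y. x \<in> R \<Longrightarrow> y \<in> R \<Longrightarrow> x \<noteq> y \<Longrightarrow> \<not> E x y"
proof -
  have "finite X \<and> r \<le> card X" using assms by simp
  from assms(1)[unfolded ramsey_bound_def, rule_format, OF this]
  obtain R where R: "R \<subseteq> X" "card R = p \<and> (\<forall>x\<in>R. \<forall>y\<in>R. x \<noteq> y \<longrightarrow> E x y) \<or>
      card R = q \<and> (\<forall>x\<in>R. \<forall>y\<in>R. x \<noteq> y \<longrightarrow> \<not> E x y)" by (elim exE conjE)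
  from R(2) show thesis
  proof
    assume "card R = p \<and> (\<forall>x\<in>R. \<forall>y\<in>R. x \<noteq> y \<longrightarrow> E x y)"
    then show thesis by (intro clique[OF R(1)]) simp_all
  next
    assume "card R = q \<and> (\<forall>x\<in>R. \<forall>y\<in>R. x \<noteq> y \<longrightarrow> \<not> E x y)"
    then show thesis by (intro coclique[OF R(1)]) simp_all
  qed
qed

context drg
begin

definition lam :: nat where "lam = b 0 - 1 - b 1"

lemma common_adj:
  assumes "E x y"
  shows "card (nb x \<inter> nb y) = lam"
proof -
  have V: "x \<in> V" "y \<in> V" using assms E_in by auto
  have d1: "d x y = 1" using d_edge assms by blast
  have part: "nb y = (nb x \<inter> nb y) \<union> (Cs x y \<union> Bs x y)"
    "(nb x \<inter> nb y) \<inter> (Cs x y \<union> Bs x y) = {}" "Cs x y \<inter> Bs x y = {}"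
  proof -
    have "d x z = 1 \<or> d x z = 0 \<or> d x z = 2" if "E y z" for z
      using d_step[OF V(1) that] d1 by linarith
    then show "nb y = (nb x \<inter> nb y) \<union> (Cs x y \<union> Bs x y)"
      using d1 d_one[OF V(1)] E_in by fastforce
    show "(nb x \<inter> nb y) \<inter> (Cs x y \<union> Bs x y) = {}" using d1 d_edge by fastforce
  qed auto
  have "card ((nb x \<inter> nb y) \<union> (Cs x y \<union> Bs x y))
      = card (nb x \<inter> nb y) + (card (Cs x y) + card (Bs x y))"
    using part(2,3) by (simp add: card_Un_disjoint)
  then have "card (nb y) = card (nb x \<inter> nb y) + (card (Cs x y) + card (Bs x y))"
    unfolding part(1)[symmetric] .
  then show ?thesis
    using card_nb[OF V(2)] card_c[OF V] card_b[OF V] d1 c_one[OF assms] by (simp add: lam_def)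
qed

lemma common_two:
  assumes "x \<in> V" "y \<in> V" "d x y = 2"
  shows "card (nb x \<inter> nb y) = c 2"
proof -
  have "nb x \<inter> nb y = Cs x y" using assms d_edge d_one[OF assms(1)] E_in by fastforce
  then show ?thesis using card_c[OF assms(1,2)] assms by simp
qed

lemma dist_two:
  assumes "E u x" "E u y" "x \<noteq> y" "\<not> E x y"
  shows "d x y = 2"
proof -
  have V: "u \<in> V" "x \<in> V" "y \<in> V" using assms E_in by auto
  have "d x y \<le> 2" using d_tri[of x u y] d_edge[of u y] d_edge[of x u] E_sym assms V by fastforce
  moreover have "d x y \<noteq> 0" "d x y \<noteq> 1" using d_zero d_one V assms by auto
  ultimately show ?thesis by linarith
qed

lemma card_common_nonadj:
  assumes "E u x" "E u y" "x \<noteq> y" "\<not> E x y"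
  shows "card (nb x \<inter> nb y) = c 2"
  using common_two dist_two[OF assms] E_in assms by blast

text \<open>Adjacent vertices have a constant number of common non-neighbours; if it is \<open>0\<close>, being equal or
  non-adjacent is transitive.\<close>

lemma card_le_of_few_nonneighbours:
  assumes co: "coconnected V E" and R: "\<And>v. v \<in> V \<Longrightarrow> card (V - nb v - {v}) \<le> R"
  shows "card V \<le> 1 + R + R * R"
proof (rule ccontr)
  assume big: "\<not> ?thesis"
  obtain x where x: "x \<in> V" using V_ne by blast
  define N where "N v = V - nb v - {v}" for v
  have fin: "finite (N v)" for v unfolding N_def by simp
  have "card (\<Union>u\<in>N x. N u) \<le> (\<Sum>u\<in>N x. card (N u))" using card_UN_le fin by blast
  also have "\<dots> \<le> (\<Sum>u\<in>N x. R)" using R by (intro sum_mono) (auto simp: N_def)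
  also have "\<dots> = card (N x) * R" by simp
  also have "\<dots> \<le> R * R" using R[OF x] by (simp add: N_def)
  finally have "card (\<Union>u\<in>N x. N u) \<le> R * R" .
  \<comment> \<open>\<open>1 + R + R * R\<close> counts \<open>x\<close>, its non-neighbours and
    theirs. A vertex beyond these is adjacent to \<open>x\<close> and has no non-neighbour in common
    with it.\<close>
  then have "card (insert x (N x \<union> (\<Union>u\<in>N x. N u))) \<le> 1 + R + R * R"
    using R[OF x] card_Un_le[of "N x" "\<Union>u\<in>N x. N u"] card_insert_le_m1 fin
    by (auto simp: card_insert_if N_def)
  then have "\<not> V \<subseteq> insert x (N x \<union> (\<Union>u\<in>N x. N u))"
    using big card_mono[of "insert x (N x \<union> (\<Union>u\<in>N x. N u))" V] fin by auto
  then obtain v where v: "v \<in> V" "v \<noteq> x" "v \<notin> N x" "\<forall>u\<in>N x. v \<notin> N u" by auto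
  then have xv: "E x v" by (auto simp: N_def)
  have un: "card (nb p \<union> nb q) = 2 * b 0 - lam" if "E p q" for p q
  proof -
    have "card (nb p) + card (nb q) = card (nb p \<union> nb q) + card (nb p \<inter> nb q)"
      by (intro card_Un_Int) auto
    then show ?thesis using common_adj[OF that] card_nb E_in[OF that] by simp
  qed
  have "nb x \<union> nb v = V"
  proof
    show "V \<subseteq> nb x \<union> nb v"
    proof
      fix u assume u: "u \<in> V"
      then consider "u = x" | "E x u" | "u \<in> N x" by (auto simp: N_def)
      then show "u \<in> nb x \<union> nb v"
      proof cases
        case 3
        then have "E u v \<or> v = u" using v by (auto simp: N_def)
        then show ?thesis using xv E_sym by auto
      qed (use E_sym[OF xv] in auto)
    qed
  qed (use nb_sub in blast)
  then have full: "nb p \<union> nb q = V" if "E p q" for p q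
    using un[OF that] un[OF xv] nb_sub by (intro card_subset_eq) auto
  have "y = x \<or> complement_graph V E x y" if "walk (complement_graph V E) n x y" for n y
    using that
  proof (induction rule: walk.induct)
    case (walkS n x y z)
    show ?case
    proof (cases "z = x")
      case False
      have "\<not> E x z" if "y \<noteq> x"
      proof
        assume "E x z"
        from full[OF this] walkS that show False 
          by (auto simp: complement_graph_def dest: E_sym)
      qed
      then show ?thesis using walkS False by (auto simp: complement_graph_def)
    qed simp
  qed simp
  moreover obtain n where "walk (complement_graph V E) n x v"
    using co x v unfolding coconnected_def connected_graph_def by blast
  ultimately show False using v xv by (auto simp: complement_graph_def)
qed

end

section \<open>Configurations excluded by positivity of \<open>A + m I\<close>\<close>

locale psd_drg = drg +
  fixes m :: nat
  assumes m2: "2 \<le> m" and psd: "0 \<le> quad f + m * ip f f"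
begin

text \<open>Along the unit vector at \<open>z\<close> the form of \<open>A + m I\<close> is a
  quadratic polynomial; this is its nonnegativity at the minimum \<open>- P / m\<close>.\<close>

lemma psd_test:
  assumes z: "z \<in> V" "f z = 0"
  shows "(adj_op f z)\<^sup>2 \<le> m * (quad f + m * ip f f)"
proof -
  define P where "P = adj_op f z"
  have m0: "0 < real m" using m2 by simp
  have "0 \<le> quad f + 2 * (- P / m) * P + m * (ip f f + (- P / m)\<^sup>2)"
    using psd[of "\<lambda>y. f y + (- P / m) * of_bool (y = z)"] z
    unfolding quad_add_single[OF z(1)] ip_add_single[OF z(1)] by (simp add: P_def)
  also have "\<dots> = (quad f + m * ip f f) - P\<^sup>2 / m"
    using m0 by (simp add: power2_eq_square field_simps)
  finally show ?thesis using m0 by (simp add: P_def field_simps)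
qed

lemma adj_op_indicator:
  assumes "finite A"
  shows "adj_op (\<lambda>x. of_bool (x \<in> A)) z = card (nb z \<inter> A)"
  unfolding adj_op_def by (simp add: of_bool_def sum.If_cases Int_def)

lemma sum_indicator: "A \<subseteq> V \<Longrightarrow> (\<Sum>x\<in>V. of_bool (x \<in> A) * h x) = (\<Sum>x\<in>A. h x :: real)"
  by (intro sum.mono_neutral_cong_right) auto

text \<open>On the indicator vector of the leaves the form of \<open>A\<close> vanishes, while the
  image at \<open>z\<close> is \<open>card S\<close>.\<close>

lemma claw_bound:
  assumes z: "z \<in> V" and S: "S \<subseteq> nb z" and co: "\<And>x y. x \<in> S \<Longrightarrow> y \<in> S \<Longrightarrow> \<not> E x y"
  shows "card S \<le> m * m"
proof -
  have SV: "S \<subseteq> V" using S nb_sub by blast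
  then have fS: "finite S" using finite_subset finV by metis
  define f where "f x = (of_bool (x \<in> S) :: real)" for x
  have A: "adj_op f x = card (nb x \<inter> S)" for x
    unfolding f_def by (rule adj_op_indicator[OF fS])
  have "quad f = (\<Sum>x\<in>S. real (card (nb x \<inter> S)))"
    unfolding ip_def A unfolding f_def by (rule sum_indicator[OF SV])
  also have "\<dots> = 0"
  proof (intro sum.neutral ballI)
    fix x assume "x \<in> S"
    then have "nb x \<inter> S = {}" using co by blast
    then show "real (card (nb x \<inter> S)) = 0" by simp
  qed
  finally have q: "quad f = 0" .
  have "ip f f = (\<Sum>x\<in>S. f x)" unfolding ip_def unfolding f_def by (rule sum_indicator[OF SV])
  then have i: "ip f f = card S" by (simp add: f_def)
  have zS: "z \<notin> S" using S E_irr by blast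
  have "nb z \<inter> S = S" using S by blast
  then have "(real (card S))\<^sup>2 \<le> m * (m * card S)"
    using psd_test[OF z, of f] q i A[of z] zS by (auto simp: f_def)
  then have "card S * card S \<le> m * m * card S"
    unfolding power2_eq_square by (metis mult.assoc of_nat_le_iff of_nat_mult)
  then show ?thesis by (cases "card S = 0") auto
qed

text \<open>Test vector \<open>1\<close> on \<open>B\<close> and \<open>-1\<close> on
  \<open>A\<close>. With \<open>t\<close> vertices in each, the squared norm is \<open>2 t\<close>,
  the form of \<open>A\<close> is \<open>- 2 t\<close> and the image at \<open>z\<close> is
  \<open>t\<close>, so \<open>psd_test\<close> gives \<open>t \<le> 2 m^2 - 2 m\<close>. Hence the
  size \<open>2 * m * m\<close>.\<close>

lemma half_clique:
  assumes z: "z \<in> V" "z \<notin> A" and cl: "\<And>x y. x \<in> A \<union> B \<Longrightarrow> y \<in> A \<union> B \<Longrightarrow> x \<noteq> y \<Longrightarrow> E x y"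
    and AB: "A \<inter> B = {}" "card A = 2 * m * m" "card B = 2 * m * m" "A \<inter> nb z = {}" "B \<subseteq> nb z"
  shows False
proof -
  define t where "t = 2 * m * m"
  have t0: "0 < t" using m2 by (simp add: t_def)
  have fin: "finite A" "finite B" using AB t0 by (auto simp: t_def intro: card_ge_0_finite)
  have BV: "B \<subseteq> V" using AB nb_sub by blast
  obtain u where u: "u \<in> B" using AB t0 t_def by fastforce
  have AV: "A \<subseteq> V" using cl[of u] u AB E_in by blast
  define f where "f x = (of_bool (x \<in> B) - of_bool (x \<in> A) :: real)" for x
  have A: "adj_op f x = real (card (nb x \<inter> B)) - real (card (nb x \<inter> A))" for x
  proof -
    have "adj_op f x = adj_op (\<lambda>x. of_bool (x \<in> B)) x - adj_op (\<lambda>x. of_bool (x \<in> A)) x"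
      unfolding f_def adj_op_def by (rule sum_subtractf)
    then show ?thesis by (simp add: adj_op_indicator fin)
  qed
  have "nb x \<inter> B = B - {x}" "nb x \<inter> A = A" if "x \<in> B" for x
    using cl[of x] that AB(1) by auto
  then have AB1: "adj_op f x = -1" if "x \<in> B" for x
    using that A AB fin t0 t_def by (simp add: of_nat_diff)
  have "nb x \<inter> A = A - {x}" "nb x \<inter> B = B" if "x \<in> A" for x
    using cl[of x] that AB(1) by auto
  then have AA1: "adj_op f x = 1" if "x \<in> A" for x
    using that A AB fin t0 t_def by (simp add: of_nat_diff)
  have split: "ip f g = (\<Sum>x\<in>B. g x) - (\<Sum>x\<in>A. g x)" for g
    unfolding ip_def f_def left_diff_distrib sum_subtractf sum_indicator[OF BV] sum_indicator[OF AV] ..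
  have q: "quad f = - 2 * real t" unfolding split using AB1 AA1 AB by (simp add: t_def)
  have i: "ip f f = 2 * real t" unfolding split
  proof -
    have "(\<Sum>x\<in>B. f x) = (\<Sum>x\<in>B. 1)" "(\<Sum>x\<in>A. f x) = (\<Sum>x\<in>A. - 1)"
      using AB(1) by (intro sum.cong; auto simp: f_def)+
    then show "sum f B - sum f A = 2 * real t" using AB by (simp add: t_def)
  qed
  have "nb z \<inter> B = B" "nb z \<inter> A = {}" using AB by auto
  then have az: "adj_op f z = t" using A[of z] AB by (simp add: t_def)
  have "f z = 0" using AB z by (auto simp: f_def)
  then have "(real t)\<^sup>2 \<le> m * (- 2 * real t + m * (2 * real t))"
    using psd_test[OF z(1), of f] az q i by simp
  also have "\<dots> = real t * (2 * real m * real m - 2 * real m)" by (simp add: algebra_simps)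
  finally have "real t \<le> 2 * real m * real m - 2 * real m"
    using t0 by (simp add: power2_eq_square)
  then show False using m2 by (simp add: t_def)
qed

definition coclique_in :: "'a \<Rightarrow> 'a set \<Rightarrow> bool" where
  "coclique_in x Y \<longleftrightarrow> Y \<subseteq> nb x \<and> (\<forall>u\<in>Y. \<forall>v\<in>Y. \<not> E u v)"

lemma ex_max_coclique: "\<exists>Y. coclique_in x Y \<and> (\<forall>Z. coclique_in x Z \<longrightarrow> card Z \<le> card Y)"
  by (rule ex_has_greatest_nat[of _ "{}" card "card (nb x) + 1"])
    (auto simp: coclique_in_def less_Suc_eq_le intro!: card_mono)

text \<open>A maximum coclique among the neighbours of \<open>x\<close> has at most
  \<open>m * m\<close> vertices by \<open>claw_bound\<close> and dominates the neighbourhood; each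
  of its vertices accounts for itself and \<open>lam\<close> others.\<close>

lemma valency_le:
  assumes "x \<in> V"
  shows "b 0 \<le> m * m * (lam + 1)"
proof -
  obtain Y where Y: "coclique_in x Y" "\<And>Z. coclique_in x Z \<Longrightarrow> card Z \<le> card Y"
    using ex_max_coclique by metis
  have Y1: "Y \<subseteq> nb x" "\<And>u v. u \<in> Y \<Longrightarrow> v \<in> Y \<Longrightarrow> \<not> E u v"
    using Y(1) unfolding coclique_in_def by auto
  have fY: "finite Y" using Y1(1) by (rule finite_subset) simp
  have "nb x \<subseteq> (\<Union>y\<in>Y. insert y (nb x \<inter> nb y))"
  proof
    fix w assume w: "w \<in> nb x"
    show "w \<in> (\<Union>y\<in>Y. insert y (nb x \<inter> nb y))"
    proof (rule ccontr)
      assume n: "w \<notin> (\<Union>y\<in>Y. insert y (nb x \<inter> nb y))"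
      then have "\<not> E w v \<and> \<not> E v w" if "v \<in> Y" for v
        using that w E_sym[of w v] by auto
      then have "coclique_in x (insert w Y)"
        using w Y1 unfolding coclique_in_def by auto
      then have "card (insert w Y) \<le> card Y" by (rule Y(2))
      then show False using n fY by (auto simp: card_insert_if)
    qed
  qed
  then have "card (nb x) \<le> card (\<Union>y\<in>Y. insert y (nb x \<inter> nb y))"
    using fY by (intro card_mono) auto
  also have "\<dots> \<le> (\<Sum>y\<in>Y. card (insert y (nb x \<inter> nb y)))" by (rule card_UN_le[OF fY])
  also have "\<dots> \<le> (\<Sum>y\<in>Y. lam + 1)"
    using Y1 common_adj by (intro sum_mono) (auto simp: card_insert_if)
  also have "\<dots> \<le> m * m * (lam + 1)"
    using mult_le_mono1[OF claw_bound[OF assms Y1], of "lam + 1"] by simp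
  finally show ?thesis using card_nb[OF assms] by simp
qed

text \<open>Counts adjacent pairs between \<open>S\<close> and the neighbours of \<open>x\<close>.
  Those neighbours outside \<open>Q\<close> contribute at most \<open>b 0 * t\<close>, that is, at
  most \<open>l / 4\<close> per element of \<open>S\<close>; so all but \<open>l / 4\<close> of the
  \<open>r\<close> common neighbours are accounted for in \<open>Q\<close>.\<close>

lemma common_count:
  assumes x: "x \<in> V" and K: "finite S" "S \<subseteq> K" "finite K"
    and r: "\<And>y. y \<in> S \<Longrightarrow> r \<le> card (nb x \<inter> nb y)"
    and Q: "\<And>v. v \<in> V \<Longrightarrow> v \<notin> Q \<Longrightarrow> card (K \<inter> nb v) \<le> t"
    and big: "8 * s * t \<le> card S" "0 < card S" and k: "b 0 \<le> 2 * s * l"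
  shows "4 * r \<le> 4 * card (nb x \<inter> Q) + l"
proof -
  have "card S * r = (\<Sum>y\<in>S. r)" by simp
  also have "\<dots> \<le> (\<Sum>y\<in>S. card (nb x \<inter> nb y))" using r by (intro sum_mono)
  also have "\<dots> = (\<Sum>y\<in>S. \<Sum>v\<in>nb x. of_bool (E y v))"
    by (intro sum.cong) (auto simp: of_bool_def sum.If_cases Int_def)
  also have "\<dots> = (\<Sum>v\<in>nb x. \<Sum>y\<in>S. of_bool (E y v))" by (rule sum.swap)
  also have "\<dots> = (\<Sum>v\<in>nb x. card (S \<inter> nb v))"
  proof (rule sum.cong)
    fix v
    have "{y \<in> S. E y v} = S \<inter> nb v" using E_sym by blast
    then show "(\<Sum>y\<in>S. of_bool (E y v)) = card (S \<inter> nb v)"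
      using K by (simp add: of_bool_def sum.If_cases Int_def)
  qed simp
  also have "\<dots> \<le> (\<Sum>v\<in>nb x. card S * of_bool (v \<in> Q) + t)"
  proof (rule sum_mono)
    fix v assume "v \<in> nb x"
    then have v: "v \<in> V" using nb_sub by blast
    show "card (S \<inter> nb v) \<le> card S * of_bool (v \<in> Q) + t"
    proof (cases "v \<in> Q")
      case True
      then show ?thesis using card_mono[OF K(1), of "S \<inter> nb v"] by simp
    next
      case False
      have "card (S \<inter> nb v) \<le> card (K \<inter> nb v)" using K by (intro card_mono) auto
      then show ?thesis using Q[OF v False] by simp
    qed
  qed
  also have "\<dots> = card S * card (nb x \<inter> Q) + b 0 * t"
  proof -
    have "(\<Sum>v\<in>nb x. of_bool (v \<in> Q)) = card (nb x \<inter> Q)"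
      by (simp add: of_bool_def sum.If_cases Int_def)
    then show ?thesis by (simp add: sum.distrib card_nb[OF x] sum_distrib_left[symmetric])
  qed
  finally have 1: "card S * r \<le> card S * card (nb x \<inter> Q) + b 0 * t" .
  have "4 * (b 0 * t) \<le> 4 * (2 * s * l * t)" using mult_le_mono1[OF k] by (rule mult_le_mono2)
  also have "\<dots> = (8 * s * t) * l" by simp
  also have "\<dots> \<le> card S * l" using big(1) by (rule mult_le_mono1)
  finally have "card S * (4 * r) \<le> card S * (4 * card (nb x \<inter> Q) + l)"
    using 1 by (simp add: algebra_simps)
  then show ?thesis using big(2) by simp
qed

text \<open>A large clique \<open>K\<close> in the common neighbourhood of two non-adjacent vertices generates the set
  \<open>Q\<close> of vertices adjacent to almost all of \<open>K\<close>; comparing \<open>\<lambda>\<close> and \<open>\<mu>\<close>, which are both large,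
  shows that \<open>Q\<close> is closed under adjacency.\<close>

lemma few_nonneighbours:
  fixes n0 R0 R1 :: nat
  defines "t \<equiv> 2 * m * m" and "s \<equiv> m * m"
  assumes n0: "n0 = 8 * s * t + t * (t + s + 4)"
    and ram0: "ramsey_bound E n0 (s + 1) R0" and ram1: "ramsey_bound E t (s + 1) R1"
    and mu: "R0 \<le> c 2" and lam: "4 * (t + 1) * R1 + 1 \<le> lam"
    and xz: "x \<in> V" "z \<in> V" "d x z = 2"
  shows "\<forall>v\<in>V. card (V - nb v - {v}) \<le> R1"
proof -
  have t0: "0 < t" "0 < s" using m2 by (auto simp: t_def s_def)
  \<comment> \<open>\<open>n0\<close> serves three needs: \<open>8 s t + 4 t\<close> for
    \<open>common_count\<close>, \<open>t (t + 1) + t\<close> for the common neighbours in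
    \<open>K\<close> of \<open>t + 1\<close> vertices, and more than \<open>t (s + 1)\<close> for
    those of \<open>s + 1\<close> vertices.\<close>
  have n0ge: "8 * s * t + 4 * t \<le> n0" unfolding n0 by (simp add: algebra_simps)
  have k: "b 0 \<le> 2 * s * lam"
  proof -
    have "b 0 \<le> s * (lam + 1)" using valency_le[OF xz(1)] by (simp add: s_def)
    also have "\<dots> \<le> s * (2 * lam)" using lam by (intro mult_le_mono) auto
    finally show ?thesis by simp
  qed
  have claw: "card S \<le> s" if "v \<in> V" "S \<subseteq> nb v" "\<And>x y. x \<in> S \<Longrightarrow> y \<in> S \<Longrightarrow> x \<noteq> y \<Longrightarrow> \<not> E x y" for v S
    using claw_bound[OF that(1,2)] that(3) E_irr unfolding s_def by metis
  have R0: "R0 \<le> card (nb x \<inter> nb z)" using common_two[OF xz] mu by simp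
  obtain K where K: "K \<subseteq> nb x \<inter> nb z" "card K = n0" "\<And>u v. u \<in> K \<Longrightarrow> v \<in> K \<Longrightarrow> u \<noteq> v \<Longrightarrow> E u v"
  proof (rule ramsey_boundE[OF ram0 _ R0])
    fix R assume coclique: "R \<subseteq> nb x \<inter> nb z" "card R = s + 1"
      "\<And>x y. x \<in> R \<Longrightarrow> y \<in> R \<Longrightarrow> x \<noteq> y \<Longrightarrow> \<not> E x y"
    then have "card R \<le> s" using claw[OF xz(1), of R] by blast
    then show thesis using coclique by simp
  qed simp_all
  have fK: "finite K" using K(1) by (rule finite_subset) simp
  have KV: "K \<subseteq> V" using K(1) nb_sub by blast
  define Q where "Q = {v\<in>V. card (K - nb v) < t}"
  \<comment> \<open>A dichotomy from \<open>half_clique\<close>: a vertex misses fewer than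
    \<open>t\<close> vertices of \<open>K\<close> or is adjacent to fewer than
    \<open>t\<close>.\<close>
  have outQ: "card (K \<inter> nb v) < t" if v: "v \<in> V" "v \<notin> Q" for v
  proof (rule ccontr)
    assume "\<not> ?thesis"
    then have "t \<le> card (K \<inter> nb v)" by simp
    then obtain B where B: "B \<subseteq> K \<inter> nb v" "card B = t"
      using ex_subset_card by meson
    have "t \<le> card (K - nb v)" using v by (auto simp: Q_def)
    then obtain A where A: "A \<subseteq> K - nb v" "card A = t"
      using ex_subset_card by meson
    have "v \<notin> K"
    proof
      assume "v \<in> K"
      then have "K - nb v \<subseteq> {v}" using K(3) by auto
      then have "card (K - nb v) \<le> 1" using card_mono[of "{v}"] by fastforce
      then have "t \<le> 1" using \<open>t \<le> card (K - nb v)\<close> by simp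
      moreover have "2 * 2 * 2 \<le> t" unfolding t_def using m2 by (intro mult_le_mono) auto
      ultimately show False by simp
    qed
    moreover have "E a b'" if "a \<in> A \<union> B" "b' \<in> A \<union> B" "a \<noteq> b'" for a b'
      using that A(1) B(1) K(3) by blast
    moreover have "A \<inter> B = {}" "A \<inter> nb v = {}" "B \<subseteq> nb v" "v \<notin> A"
      using A(1) B(1) \<open>v \<notin> K\<close> by auto
    moreover have "card A = 2 * m * m" "card B = 2 * m * m" using A(2) B(2) t_def by auto
    ultimately show False using half_clique[of v A B] v(1) by blast
  qed
  have xQ: "x \<in> Q" "z \<in> Q"
  proof -
    have "card (K - nb x) = 0" "card (K - nb z) = 0" using K(1) by (auto simp: fK)
    then show "x \<in> Q" "z \<in> Q" using xz t0 unfolding Q_def by auto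
  qed
  have QV: "Q \<subseteq> V" by (auto simp: Q_def)
  have fQ: "finite Q" using QV finite_subset finV by metis
  have common: "n0 - t * card Z \<le> card {u\<in>K. \<forall>v\<in>Z. E v u}" if "finite Z" "Z \<subseteq> Q" for Z
  proof -
    have "K - {u\<in>K. \<forall>v\<in>Z. E v u} \<subseteq> (\<Union>v\<in>Z. K - nb v)" by auto
    then have "card (K - {u\<in>K. \<forall>v\<in>Z. E v u}) \<le> card (\<Union>v\<in>Z. K - nb v)"
      using that fK by (intro card_mono) auto
    also have "\<dots> \<le> (\<Sum>v\<in>Z. card (K - nb v))" by (rule card_UN_le[OF that(1)])
    also have "\<dots> \<le> (\<Sum>v\<in>Z. t)" using that by (intro sum_mono) (auto simp: Q_def)
    finally have "card (K - {u\<in>K. \<forall>v\<in>Z. E v u}) \<le> t * card Z" by (simp add: mult.commute)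
    moreover have "card (K - {u\<in>K. \<forall>v\<in>Z. E v u}) = n0 - card {u\<in>K. \<forall>v\<in>Z. E v u}"
      using fK K(2) by (subst card_Diff_subset) auto
    ultimately show ?thesis by linarith
  qed
  \<comment> \<open>Among \<open>R1\<close> non-neighbours of \<open>v\<close> in \<open>Q\<close>,
    a clique joined to common neighbours in \<open>K\<close> contradicts \<open>half_clique\<close>;
    a coclique has a common neighbour in \<open>K\<close>, the centre of too large a claw.\<close>
  have nonnb: "card (Q - nb v - {v}) < R1" if v: "v \<in> Q" for v
  proof (rule ccontr)
    assume "\<not> ?thesis"
    then have le: "R1 \<le> card (Q - nb v - {v})" by simp
    have fin: "finite (Q - nb v - {v})" using fQ by simp
    show False
    proof (cases rule: ramsey_boundE[OF ram1 fin le, case_names clique coclique])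
      case (clique Z)
      note Z = clique(1)
      have fZ: "finite Z" using Z by (rule finite_subset) (use fQ in simp)
      have vZ: "v \<notin> Z" using Z by auto
      have "n0 - t * card (insert v Z) \<le> card {u\<in>K. \<forall>v'\<in>insert v Z. E v' u}"
        using common[of "insert v Z"] fZ Z v by blast
      moreover have "t \<le> n0 - t * (t + 1)" using n0 by (simp add: algebra_simps)
      ultimately have "t \<le> card {u\<in>K. \<forall>v'\<in>insert v Z. E v' u}" using clique(2) fZ vZ by auto
      then obtain B where B: "B \<subseteq> {u\<in>K. \<forall>v'\<in>insert v Z. E v' u}" "card B = t"
        using ex_subset_card by meson
      have cl: "E a b'" if "a \<in> Z \<union> B" "b' \<in> Z \<union> B" "a \<noteq> b'" for a b'
        using that clique(3) B K(3) E_sym by blast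
      have ZB: "Z \<inter> B = {}" "Z \<inter> nb v = {}" "B \<subseteq> nb v" using B(1) Z by auto
      have "card Z = 2 * m * m" "card B = 2 * m * m" using clique(2) B(2) t_def by auto
      moreover have "v \<in> V" using v QV by blast
      ultimately show False using half_clique[OF _ vZ cl ZB(1) _ _ ZB(2,3)] by blast
    next
      case (coclique Z)
      note Z = coclique(1)
      have fZ: "finite Z" using Z by (rule finite_subset) (use fQ in simp)
      have "n0 - t * (s + 1) \<le> card {u\<in>K. \<forall>v'\<in>Z. E v' u}"
        using common[OF fZ] Z coclique(2) by auto
      moreover have "0 < n0 - t * (s + 1)" using n0 t0 by (simp add: algebra_simps)
      ultimately have "{u\<in>K. \<forall>v'\<in>Z. E v' u} \<noteq> {}" by (metis card.empty not_less)
      then obtain u where u: "u \<in> K" "\<forall>v'\<in>Z. E v' u" by blast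
      have "Z \<subseteq> nb u" using u E_sym by blast
      then have "card Z \<le> s" using claw[of u Z] u KV coclique(3) by blast
      then show False using coclique(2) by simp
    qed
  qed
  then have nonnb_le: "card (Q - nb v - {v}) \<le> R1" if "v \<in> Q" for v
    using that less_imp_le by blast
  have inQ: "3 * lam \<le> 4 * card (nb v \<inter> Q)" if v: "v \<in> Q" for v
  proof -
    have vV: "v \<in> V" using v QV by blast
    have "card (K \<inter> nb v) = card K - card (K - nb v)"
      using fK card_Diff_subset[of "K - nb v" K] by (simp add: Diff_Diff_Int)
    then have big: "8 * s * t + t \<le> card (K \<inter> nb v)"
      using v K(2) n0ge unfolding Q_def by (simp only: mem_Collect_eq) linarith
    have "4 * lam \<le> 4 * card (nb v \<inter> Q) + lam"
    proof (rule common_count[where S = "K \<inter> nb v" and K = K and t = t and s = s])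
      show "lam \<le> card (nb v \<inter> nb y)" if "y \<in> K \<inter> nb v" for y using common_adj[of v y] that by auto
      show "card (K \<inter> nb u) \<le> t" if "u \<in> V" "u \<notin> Q" for u using outQ[OF that] by simp
    qed (use vV fK big t0 k in auto)
    then show ?thesis by simp
  qed
  \<comment> \<open>All but \<open>R1\<close> of the neighbours of \<open>x\<close> in
    \<open>Q\<close> are adjacent to \<open>z\<close> or equal to it, so \<mu> cannot be much
    smaller than \<lambda>.\<close>
  have mu2: "lam \<le> 2 * c 2"
  proof -
    have "nb x \<inter> Q \<subseteq> (nb x \<inter> nb z) \<union> (Q - nb z - {z})"
      using d_one[OF xz(1,2)] xz(3) by auto
    then have "card (nb x \<inter> Q) \<le> card ((nb x \<inter> nb z) \<union> (Q - nb z - {z}))"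
      using fQ by (intro card_mono) auto
    also have "\<dots> \<le> c 2 + R1"
      using card_Un_le[of "nb x \<inter> nb z" "Q - nb z - {z}"] common_two[OF xz] nonnb[OF xQ(2)] by linarith
    finally have "3 * lam \<le> 4 * c 2 + 4 * R1" using inQ[OF xQ(1)] by linarith
    moreover have "4 * R1 \<le> lam"
    proof -
      have "4 * 1 * R1 \<le> 4 * (t + 1) * R1" by (intro mult_le_mono) auto
      then show ?thesis using lam by linarith
    qed
    ultimately show ?thesis by linarith
  qed
  have closed: "w \<in> Q" if v: "v \<in> Q" and vw: "E v w" for v w
  proof (rule ccontr)
    assume w: "w \<notin> Q"
    have V: "v \<in> V" "w \<in> V" using E_in vw by auto
    \<comment> \<open>These vertices are at distance two from \<open>w\<close>, through
      \<open>v\<close>. Each shares \<open>c 2\<close> neighbours with \<open>w\<close>, which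
      forces at least \<open>lam / 4\<close> neighbours of \<open>w\<close> into
      \<open>Q\<close>.\<close>
    define S where "S = (K \<inter> nb v) - nb w - {w}"
    have "K - S \<subseteq> (K - nb v) \<union> (K \<inter> nb w) \<union> {w}" unfolding S_def by auto
    then have "card (K - S) \<le> card ((K - nb v) \<union> (K \<inter> nb w) \<union> {w})" using fK by (intro card_mono) auto
    also have "\<dots> \<le> card (K - nb v) + card (K \<inter> nb w) + 1"
      using card_Un_le[of "(K - nb v) \<union> (K \<inter> nb w)" "{w}"] card_Un_le[of "K - nb v" "K \<inter> nb w"] by simp
    also have "\<dots> \<le> 2 * t" using v outQ[OF V(2) w] unfolding Q_def by simp
    finally have "card (K - S) \<le> 2 * t" .
    moreover have SK: "S \<subseteq> K" unfolding S_def by blast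
    moreover have "card (K - S) = card K - card S" using SK fK by (meson card_Diff_subset finite_subset)
    ultimately have big: "8 * s * t + t \<le> card S"
      using K(2) n0ge by linarith
    have fS: "finite S" using SK fK finite_subset by metis
    have "4 * c 2 \<le> 4 * card (nb w \<inter> Q) + lam"
    proof (rule common_count[where S = S and K = K and t = t and s = s])
      show "c 2 \<le> card (nb w \<inter> nb y)" if "y \<in> S" for y
        using card_common_nonadj[of v w y] that vw unfolding S_def by auto
      show "card (K \<inter> nb u) \<le> t" if "u \<in> V" "u \<notin> Q" for u using outQ[OF that] by simp
    qed (use V fK fS SK big t0 k in auto)
    then have wQ: "lam \<le> 4 * card (nb w \<inter> Q)" using mu2 by linarith
    have "t \<le> card S" using big by simp
    then obtain A where A: "A \<subseteq> S" "card A = t" using ex_subset_card by meson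
    have fA: "finite A" using A(1) fS finite_subset by metis
    have AQ: "A \<subseteq> Q"
    proof
      fix a assume "a \<in> A"
      then have a: "a \<in> K" using A SK by blast
      then have "K - nb a \<subseteq> {a}" using K(3) by auto
      then have "card (K - nb a) \<le> 1" using card_mono[of "{a}"] by fastforce
      moreover have "2 * 2 * 2 \<le> t" unfolding t_def using m2 by (intro mult_le_mono) auto
      ultimately show "a \<in> Q" using a KV unfolding Q_def by auto
    qed
    \<comment> \<open>Each of the \<open>t\<close> vertices of \<open>A\<close> costs at most
      \<open>R1\<close> vertices, so the hypothesis on \<open>lam\<close> leaves \<open>R1\<close>
      of them in \<open>X\<close>. There a clique contradicts \<open>half_clique\<close> and a
      coclique is a claw at \<open>w\<close>.\<close>
    define X where "X = {u \<in> nb w \<inter> Q. \<forall>a\<in>A. E a u}"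
    have Aw: "a \<notin> nb w" "a \<noteq> w" if "a \<in> A" for a using that A unfolding S_def by auto
    have "nb w \<inter> Q \<subseteq> X \<union> (\<Union>a\<in>A. Q - nb a - {a})"
      using Aw unfolding X_def by auto
    then have "card (nb w \<inter> Q) \<le> card (X \<union> (\<Union>a\<in>A. Q - nb a - {a}))"
      using fA fQ unfolding X_def by (intro card_mono) auto
    also have "\<dots> \<le> card X + card (\<Union>a\<in>A. Q - nb a - {a})" by (rule card_Un_le)
    also have "card (\<Union>a\<in>A. Q - nb a - {a}) \<le> (\<Sum>a\<in>A. card (Q - nb a - {a}))" by (rule card_UN_le[OF fA])
    also have "\<dots> \<le> (\<Sum>a\<in>A. R1)" using nonnb_le AQ by (intro sum_mono) blast
    also have "\<dots> = t * R1" using A by simp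
    finally have "R1 \<le> card X" using wQ lam by (simp add: algebra_simps)
    moreover have "finite X" unfolding X_def by simp
    ultimately show False using ram1
    proof (elim ramsey_boundE)
      fix B assume B: "B \<subseteq> X" "card B = t" and cl: "\<And>x y. x \<in> B \<Longrightarrow> y \<in> B \<Longrightarrow> x \<noteq> y \<Longrightarrow> E x y"
      have 1: "E a u" if "a \<in> A" "u \<in> B" for a u using B(1) that unfolding X_def by blast
      have 2: "E a u" if "a \<in> A" "u \<in> A" "a \<noteq> u" for a u using K(3)[of a u] A(1) SK that by blast
      have clAB: "E a u" if "a \<in> A \<union> B" "u \<in> A \<union> B" "a \<noteq> u" for a u
        using 1[of a u] E_sym[OF 1[of u a]] 2[of a u] cl[of a u] that by blast
      have AB: "A \<inter> B = {}" "A \<inter> nb w = {}" "B \<subseteq> nb w" "w \<notin> A"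
        using B(1) Aw unfolding X_def by auto
      have "card A = 2 * m * m" "card B = 2 * m * m" using A(2) B(2) t_def by auto
      then show False using half_clique[OF V(2) AB(4) clAB AB(1) _ _ AB(2,3)] by blast
    next
      fix B assume B: "B \<subseteq> X" "card B = s + 1" and co: "\<And>x y. x \<in> B \<Longrightarrow> y \<in> B \<Longrightarrow> x \<noteq> y \<Longrightarrow> \<not> E x y"
      have "B \<subseteq> nb w" using B(1) unfolding X_def by auto
      then have "card B \<le> s" using claw[OF V(2), of B] co by blast
      then show False using B(2) by simp
    qed
  qed
  have "y \<in> Q" if "walk E n x y" for n y
    using that xQ(1) by (induction rule: walk.induct) (auto intro: closed)
  then have VQ: "V = Q" using QV ex_walk[OF xz(1)] by blast
  show ?thesis unfolding VQ using nonnb_le by blast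
qed

end

section \<open>Lines\<close>

context psd_drg
begin

definition maxclique :: "'a set \<Rightarrow> bool" where
  "maxclique C \<longleftrightarrow> is_clique V E C \<and> (\<forall>v\<in>V. (\<forall>w\<in>C. v \<noteq> w \<longrightarrow> E v w) \<longrightarrow> v \<in> C)"

lemma is_cliqueD: "is_clique V E C \<Longrightarrow> x \<in> C \<Longrightarrow> y \<in> C \<Longrightarrow> x \<noteq> y \<Longrightarrow> E x y"
  unfolding is_clique_def by blast

lemma clique_sub: "is_clique V E C \<Longrightarrow> C \<subseteq> V"
  unfolding is_clique_def by blast

lemma clique_fin: "is_clique V E C \<Longrightarrow> finite C"
  using finite_subset[OF clique_sub finV] .

lemma ex_maxclique:
  assumes "is_clique V E A"
  shows "\<exists>C. maxclique C \<and> A \<subseteq> C"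
proof -
  have "\<exists>C. (is_clique V E C \<and> A \<subseteq> C) \<and> (\<forall>D. is_clique V E D \<and> A \<subseteq> D \<longrightarrow> card D \<le> card C)"
    by (rule ex_has_greatest_nat[of _ A card "card V + 1"])
      (use assms in \<open>auto simp: less_Suc_eq_le is_clique_def intro!: card_mono\<close>)
  then obtain C where C: "is_clique V E C" "A \<subseteq> C"
    "\<And>D. is_clique V E D \<Longrightarrow> A \<subseteq> D \<Longrightarrow> card D \<le> card C" by metis
  have "v \<in> C" if v: "v \<in> V" "\<forall>w\<in>C. v \<noteq> w \<longrightarrow> E v w" for v
  proof (rule ccontr)
    assume n: "v \<notin> C"
    have "is_clique V E (insert v C)"
      using C(1) v E_sym[of v] unfolding is_clique_def by auto
    then have "card (insert v C) \<le> card C" using C(2,3) by blast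
    then show False using n clique_fin[OF C(1)] by simp
  qed
  then show ?thesis using C unfolding maxclique_def by blast
qed

lemma clique_card_le:
  assumes C: "is_clique V E C" "x \<in> C" "y \<in> C" "x \<noteq> y"
  shows "C \<subseteq> {x, y} \<union> (nb x \<inter> nb y)"
  using is_cliqueD[OF C(1) C(2)] is_cliqueD[OF C(1) C(3)] by auto

lemma card_edge_closed: "E x y \<Longrightarrow> card ({x, y} \<union> (nb x \<inter> nb y)) = lam + 2"
proof -
  assume xy: "E x y"
  then have "x \<noteq> y" by auto
  then show ?thesis using common_adj[OF xy] by (simp add: card_insert_if)
qed

end

locale line_drg = psd_drg +
  fixes M :: nat
  assumes mu: "c 2 \<le> M" and lam: "4 * (m * m) * (m * m) * (M + 1) \<le> lam"
begin

definition s :: nat where "s = m * m"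

lemma s_pos: "0 < s"
  using m2 by (simp add: s_def)

text \<open>Each left side is a sum of at most three terms bounded by
  \<open>s * s * (M + 1)\<close>, and \<open>lam\<close> is at least four times that; this fixes the
  constant in the locale.\<close>

lemma lam_bounds:
  "s * (M + 1) + s * s * M < lam" "M + 2 * (s * M) < lam"
  "s * M * (2 * s + 1) < lam" "s * M + 2 * s < lam" "2 * (s * M) < lam"
proof -
  define X where "X = s * s * (M + 1)"
  have X: "4 * X \<le> lam" "0 < X" using lam s_pos by (simp_all add: X_def s_def mult.assoc)
  have ss: "s \<le> s * s" "1 \<le> s * s" using s_pos by simp_all
  have 1: "s * (M + 1) \<le> X" "s * s * M \<le> X" "1 * M \<le> X" "s * M \<le> X" "s * 1 \<le> X"
    unfolding X_def using ss by (intro mult_le_mono; simp)+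
  have 2: "s * M * (2 * s + 1) = 2 * (s * s * M) + s * M" by (simp add: algebra_simps)
  show "s * (M + 1) + s * s * M < lam" "M + 2 * (s * M) < lam"
    "s * M * (2 * s + 1) < lam" "s * M + 2 * s < lam" "2 * (s * M) < lam"
    using X 1 unfolding 2 by linarith+
qed

text \<open>No clique containing an edge exceeds \<open>lam + 2\<close>. The defect
  \<open>s * M\<close> arises in \<open>line_cover\<close>: each of at most \<open>s\<close> other
  claw vertices excludes at most \<open>M\<close> common neighbours.\<close>

definition lines :: "'a set set" where
  "lines = {C. maxclique C \<and> lam + 2 \<le> card C + s * M}"

lemma line_clique: "C \<in> lines \<Longrightarrow> is_clique V E C"
  unfolding lines_def maxclique_def by blast

lemma finite_lines [simp]: "finite lines"
  by (rule finite_subset[of _ "Pow V"]) (use line_clique clique_sub in auto)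

text \<open>The cliques \<open>A u\<close> are built around a maximum coclique in the neighbourhood
  of \<open>x\<close>, without regard to \<open>y\<close>. Afterwards \<open>y\<close> is captured:
  it has more neighbours in some \<open>A u\<close> than it can share with a vertex at distance
  two.\<close>

lemma line_cover:
  assumes xy: "E x y"
  shows "\<exists>C\<in>lines. x \<in> C \<and> y \<in> C"
proof -
  have xV: "x \<in> V" "y \<in> V" using E_in xy by auto
  obtain Y where Y: "coclique_in x Y" "\<And>Z. coclique_in x Z \<Longrightarrow> card Z \<le> card Y"
    using ex_max_coclique by metis
  have Y1: "Y \<subseteq> nb x" "\<And>u v. u \<in> Y \<Longrightarrow> v \<in> Y \<Longrightarrow> \<not> E u v"
    using Y(1) unfolding coclique_in_def by auto
  have fY: "finite Y" using Y1(1) by (rule finite_subset) simp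
  have cY: "card Y \<le> s" using claw_bound[OF xV(1) Y1] by (simp add: s_def)
  define P where "P u = {w \<in> nb x \<inter> nb u. \<forall>v\<in>Y - {u}. \<not> E w v}" for u
  define A where "A u = insert x (insert u (P u))" for u
  have common_Y: "card (nb u \<inter> nb v) \<le> M" if "u \<in> Y" "v \<in> Y" "u \<noteq> v" for u v
  proof -
    have "E x u" "E x v" using that Y1(1) by auto
    then show ?thesis using card_common_nonadj[of x u v] that Y1(2) mu by simp
  qed
  \<comment> \<open>Two non-adjacent vertices of \<open>P u\<close> could replace \<open>u\<close>
    in \<open>Y\<close>, giving a larger coclique.\<close>
  have Pcl: "E w w'" if u: "u \<in> Y" and w: "w \<in> P u" "w' \<in> P u" "w \<noteq> w'" for u w w'
  proof (rule ccontr)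
    assume n: "\<not> E w w'"
    have nY: "w \<notin> Y" "w' \<notin> Y" using Y1(2) u w E_sym unfolding P_def by blast+
    have 1: "\<not> E w v \<and> \<not> E v w \<and> \<not> E w' v \<and> \<not> E v w'" if "v \<in> Y - {u}" for v
      using w that E_sym[of v w] E_sym[of v w'] unfolding P_def by blast
    have 2: "\<not> E w' w" using n E_sym by blast
    have "\<not> E a a'" if "a \<in> insert w (insert w' (Y - {u}))" "a' \<in> insert w (insert w' (Y - {u}))" for a a'
      using that 1[of a] 1[of a'] n 2 Y1(2)[of a a'] by auto
    moreover have "insert w (insert w' (Y - {u})) \<subseteq> nb x" using w Y1(1) unfolding P_def by auto
    ultimately have "coclique_in x (insert w (insert w' (Y - {u})))"
      unfolding coclique_in_def by blast
    then have "card (insert w (insert w' (Y - {u}))) \<le> card Y" by (rule Y(2))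
    moreover have "card (insert w (insert w' (Y - {u}))) = card (Y - {u}) + 2"
      using nY w(3) fY by simp
    moreover have "card (Y - {u}) + 1 = card Y" using card_Suc_Diff1[OF fY u] by simp
    ultimately show False by linarith
  qed
  have Acl: "is_clique V E (A u)" if u: "u \<in> Y" for u
  proof -
    have xu: "E x u" using u Y1(1) by auto
    have "A u \<subseteq> V" using xV E_in xu nb_sub unfolding A_def P_def by blast
    moreover have "E a a'" if "a \<in> A u" "a' \<in> A u" "a \<noteq> a'" for a a'
    proof -
      have 1: "E x v" if "v \<in> P u" for v using that unfolding P_def by blast
      have 2: "E u v" if "v \<in> P u" for v using that unfolding P_def by blast
      show ?thesis
        using that xu E_sym[OF xu] 1[of a] 1[of a'] 2[of a] 2[of a'] E_sym[of x a] E_sym[of u a]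
          Pcl[OF u, of a a'] unfolding A_def by blast
    qed
    ultimately show ?thesis unfolding is_clique_def by blast
  qed
  have Acard: "lam + 2 \<le> card (A u) + s * M" if u: "u \<in> Y" for u
  proof -
    have xu: "E x u" using u Y1(1) by auto
    have fP: "finite (P u)" unfolding P_def by simp
    have "nb x \<inter> nb u \<subseteq> P u \<union> (\<Union>v\<in>Y - {u}. nb u \<inter> nb v)"
      unfolding P_def by (auto dest: E_sym)
    then have "card (nb x \<inter> nb u) \<le> card (P u \<union> (\<Union>v\<in>Y - {u}. nb u \<inter> nb v))"
      using fP fY by (intro card_mono) auto
    also have "\<dots> \<le> card (P u) + card (\<Union>v\<in>Y - {u}. nb u \<inter> nb v)" by (rule card_Un_le)
    also have "card (\<Union>v\<in>Y - {u}. nb u \<inter> nb v) \<le> (\<Sum>v\<in>Y - {u}. card (nb u \<inter> nb v))"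
      using fY by (intro card_UN_le) simp
    also have "\<dots> \<le> (\<Sum>v\<in>Y - {u}. M)" using common_Y u by (intro sum_mono) auto
    also have "\<dots> = card (Y - {u}) * M" by simp
    also have "\<dots> \<le> s * M" using cY card_Diff1_le[of Y u] by (intro mult_le_mono1) linarith
    finally have "lam \<le> card (P u) + s * M" using common_adj[OF xu] by simp
    moreover have "card (A u) = card (P u) + 2"
      using fP xu unfolding A_def P_def by (auto simp: card_insert_if)
    ultimately show ?thesis by simp
  qed
  \<comment> \<open>Otherwise the \<open>lam\<close> common neighbours of \<open>x\<close> and
    \<open>y\<close> are too few: \<open>s (M + 1)\<close> of them in the cliques, and at most
    \<open>s * s * M\<close> adjacent to two vertices of \<open>Y\<close>.\<close>
  have "\<exists>u\<in>Y. M + 1 < card (nb y \<inter> A u)"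
  proof (rule ccontr)
    assume n: "\<not> ?thesis"
    have "nb x \<inter> nb y \<subseteq> (\<Union>u\<in>Y. nb y \<inter> A u) \<union> (\<Union>u\<in>Y. \<Union>v\<in>Y - {u}. nb u \<inter> nb v)"
    proof
      fix w assume w: "w \<in> nb x \<inter> nb y"
      show "w \<in> (\<Union>u\<in>Y. nb y \<inter> A u) \<union> (\<Union>u\<in>Y. \<Union>v\<in>Y - {u}. nb u \<inter> nb v)"
      proof (cases "w \<in> Y")
        case True
        then show ?thesis using w unfolding A_def by auto
      next
        case False
        have "\<exists>u\<in>Y. E u w"
        proof (rule ccontr)
          assume "\<not> ?thesis"
          then have "coclique_in x (insert w Y)"
            using w Y1 unfolding coclique_in_def by (auto dest: E_sym)
          then have "card (insert w Y) \<le> card Y" by (rule Y(2))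
          then show False using False fY by simp
        qed
        then obtain u where u: "u \<in> Y" "E u w" by blast
        show ?thesis
        proof (cases "w \<in> P u")
          case True
          then show ?thesis using u w unfolding A_def by auto
        next
          case False
          then obtain v where "v \<in> Y - {u}" "E w v" using w u unfolding P_def by auto
          then have "w \<in> nb u \<inter> nb v" using u E_sym by auto
          then show ?thesis using u \<open>v \<in> Y - {u}\<close> by blast
        qed
      qed
    qed
    then have "card (nb x \<inter> nb y)
        \<le> card ((\<Union>u\<in>Y. nb y \<inter> A u) \<union> (\<Union>u\<in>Y. \<Union>v\<in>Y - {u}. nb u \<inter> nb v))"
      using fY by (intro card_mono) auto
    also have "\<dots> \<le> card (\<Union>u\<in>Y. nb y \<inter> A u) + card (\<Union>u\<in>Y. \<Union>v\<in>Y - {u}. nb u \<inter> nb v)"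
      by (rule card_Un_le)
    also have "card (\<Union>u\<in>Y. nb y \<inter> A u) \<le> s * (M + 1)"
    proof -
      have "card (\<Union>u\<in>Y. nb y \<inter> A u) \<le> (\<Sum>u\<in>Y. card (nb y \<inter> A u))" by (rule card_UN_le[OF fY])
      also have "\<dots> \<le> (\<Sum>u\<in>Y. M + 1)" using n by (intro sum_mono) (auto simp: not_less)
      also have "\<dots> = card Y * (M + 1)" by simp
      also have "\<dots> \<le> s * (M + 1)" using cY by (rule mult_le_mono1)
      finally show ?thesis .
    qed
    also have "card (\<Union>u\<in>Y. \<Union>v\<in>Y - {u}. nb u \<inter> nb v) \<le> s * s * M"
    proof -
      have 1: "card (\<Union>v\<in>Y - {u}. nb u \<inter> nb v) \<le> s * M" if u: "u \<in> Y" for u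
      proof -
        have "card (\<Union>v\<in>Y - {u}. nb u \<inter> nb v) \<le> (\<Sum>v\<in>Y - {u}. card (nb u \<inter> nb v))"
          using fY by (intro card_UN_le) simp
        also have "\<dots> \<le> (\<Sum>v\<in>Y - {u}. M)" using common_Y u by (intro sum_mono) auto
        also have "\<dots> = card (Y - {u}) * M" by simp
        also have "\<dots> \<le> s * M" using cY card_Diff1_le[of Y u] by (intro mult_le_mono1) linarith
        finally show ?thesis .
      qed
      have "card (\<Union>u\<in>Y. \<Union>v\<in>Y - {u}. nb u \<inter> nb v) \<le> (\<Sum>u\<in>Y. card (\<Union>v\<in>Y - {u}. nb u \<inter> nb v))"
        by (rule card_UN_le[OF fY])
      also have "\<dots> \<le> (\<Sum>u\<in>Y. s * M)" using 1 by (intro sum_mono)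
      also have "\<dots> = card Y * (s * M)" by simp
      also have "\<dots> \<le> s * (s * M)" using cY by (rule mult_le_mono1)
      finally show ?thesis by (simp add: mult.assoc)
    qed
    finally show False using common_adj[OF xy] lam_bounds(1) by simp
  qed
  then obtain u where u: "u \<in> Y" "M + 1 < card (nb y \<inter> A u)" by blast
  obtain C where C: "maxclique C" "A u \<subseteq> C" using ex_maxclique[OF Acl[OF u(1)]] by blast
  have Ccl: "is_clique V E C" using C unfolding maxclique_def by blast
  have "card (A u) \<le> card C" using C clique_fin[OF Ccl] by (intro card_mono)
  then have CL: "C \<in> lines" using C Acard[OF u(1)] unfolding lines_def by auto
  have xC: "x \<in> C" using C unfolding A_def by auto
  have "y \<in> C"
  proof (rule ccontr)
    assume "y \<notin> C"
    then obtain w where w: "w \<in> C" "y \<noteq> w" "\<not> E y w" using C(1) xV unfolding maxclique_def by blast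
    have "w \<noteq> x" using w xy E_sym by blast
    then have "E x w" using is_cliqueD[OF Ccl xC w(1)] by blast
    then have "card (nb y \<inter> nb w) \<le> M" using card_common_nonadj[OF xy] w mu by auto
    moreover have "nb y \<inter> A u \<subseteq> nb y \<inter> nb w"
      using C(2) w is_cliqueD[OF Ccl w(1)] by blast
    then have "card (nb y \<inter> A u) \<le> card (nb y \<inter> nb w)" by (intro card_mono) auto
    ultimately show False using u by simp
  qed
  then show ?thesis using CL xC by blast
qed

text \<open>Distinct maximal cliques contain non-adjacent \<open>w\<close> and \<open>w'\<close>, so
  they meet in at most \<open>M\<close> vertices; through a common edge their union has at most
  \<open>lam + 2\<close> vertices, too few for two lines.\<close>

lemma line_unique:
  assumes C: "C \<in> lines" "D \<in> lines" "x \<in> C" "y \<in> C" "x \<in> D" "y \<in> D" "x \<noteq> y"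
  shows "C = D"
proof (rule ccontr)
  assume ne: "C \<noteq> D"
  have cl: "is_clique V E C" "is_clique V E D" using C line_clique by auto
  have max: "maxclique C" "maxclique D" using C unfolding lines_def by auto
  have xy: "E x y" using is_cliqueD[OF cl(1)] C by blast
  have fin: "finite C" "finite D" using cl clique_fin by auto
  have "\<not> C \<subseteq> D"
  proof
    assume s: "C \<subseteq> D"
    have "D \<subseteq> C"
    proof
      fix v assume v: "v \<in> D"
      then have "\<forall>w\<in>C. v \<noteq> w \<longrightarrow> E v w" using is_cliqueD[OF cl(2) v] s by blast
      then show "v \<in> C" using max(1) v clique_sub[OF cl(2)] unfolding maxclique_def by blast
    qed
    then show False using s ne by blast
  qed
  then obtain w where w: "w \<in> C" "w \<notin> D" by blast
  then obtain w' where w': "w' \<in> D" "w \<noteq> w'" "\<not> E w w'"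
    using max(2) clique_sub[OF cl(1)] unfolding maxclique_def by blast
  have w'C: "w' \<notin> C" using is_cliqueD[OF cl(1) w(1)] w' by blast
  have "E x w" "E x w'"
    using is_cliqueD[OF cl(1) C(3) w(1)] is_cliqueD[OF cl(2) C(5) w'(1)] w w'C C by auto
  then have "card (nb w \<inter> nb w') \<le> M" using card_common_nonadj w' mu by auto
  moreover have "C \<inter> D \<subseteq> nb w \<inter> nb w'"
    using is_cliqueD[OF cl(1) w(1)] is_cliqueD[OF cl(2) w'(1)] w w'C by blast
  then have "card (C \<inter> D) \<le> card (nb w \<inter> nb w')" by (intro card_mono) auto
  ultimately have int: "card (C \<inter> D) \<le> M" by simp
  have "C \<union> D \<subseteq> {x, y} \<union> (nb x \<inter> nb y)"
    using clique_card_le[OF cl(1) C(3,4,7)] clique_card_le[OF cl(2) C(5,6,7)] by blast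
  then have "card (C \<union> D) \<le> card ({x, y} \<union> (nb x \<inter> nb y))" by (intro card_mono) auto
  then have un: "card (C \<union> D) \<le> lam + 2" using card_edge_closed[OF xy] by simp
  have "card C + card D = card (C \<union> D) + card (C \<inter> D)" using fin by (rule card_Un_Int)
  moreover have "lam + 2 \<le> card C + s * M" "lam + 2 \<le> card D + s * M"
    using C unfolding lines_def by auto
  ultimately show False using un int lam_bounds(2) by linarith
qed

lemma line_card:
  assumes "C \<in> lines"
  shows "lam + 2 \<le> card C + s * M" "2 \<le> card C" "card C \<le> lam + 2"
proof -
  show 1: "lam + 2 \<le> card C + s * M" using assms unfolding lines_def by blast
  then show 2: "2 \<le> card C" using lam_bounds by linarith
  have fC: "finite C" using assms line_clique clique_fin by blast
  obtain x where x: "x \<in> C" using 2 by fastforce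
  have "card (C - {x}) \<noteq> 0" using 2 x fC by simp
  then have "C - {x} \<noteq> {}" by (metis card.empty)
  then obtain y where y: "y \<in> C" "x \<noteq> y" by blast
  have "card C \<le> card ({x, y} \<union> (nb x \<inter> nb y))"
    using clique_card_le[OF line_clique[OF assms] x y] by (intro card_mono) auto
  also have "\<dots> = lam + 2"
    using card_edge_closed is_cliqueD[OF line_clique[OF assms] x y] by blast
  finally show "card C \<le> lam + 2" .
qed

section \<open>Lines through a vertex\<close>

definition lines_at :: "'a \<Rightarrow> 'a set set" where "lines_at x = {C \<in> lines. x \<in> C}"

lemma finite_lines_at [simp]: "finite (lines_at x)"
  unfolding lines_at_def by simp

lemma sum_nb_lines:
  fixes g :: "'a \<Rightarrow> 'r::comm_monoid_add"
  shows "(\<Sum>y\<in>nb x. g y) = (\<Sum>C\<in>lines_at x. \<Sum>y\<in>C - {x}. g y)"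
proof -
  have "nb x = (\<Union>C\<in>lines_at x. C - {x})"
  proof
    show "nb x \<subseteq> (\<Union>C\<in>lines_at x. C - {x})"
      using line_cover unfolding lines_at_def by fastforce
    show "(\<Union>C\<in>lines_at x. C - {x}) \<subseteq> nb x"
      using is_cliqueD[OF line_clique] unfolding lines_at_def by blast
  qed
  moreover have "(\<Sum>y\<in>(\<Union>C\<in>lines_at x. C - {x}). g y) = (\<Sum>C\<in>lines_at x. \<Sum>y\<in>C - {x}. g y)"
  proof (rule sum.UNION_disjoint)
    show "\<forall>C\<in>lines_at x. finite (C - {x})"
      using line_clique clique_fin unfolding lines_at_def by blast
    show "\<forall>C\<in>lines_at x. \<forall>D\<in>lines_at x. C \<noteq> D \<longrightarrow> (C - {x}) \<inter> (D - {x}) = {}"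
      using line_unique unfolding lines_at_def by blast
  qed simp
  ultimately show ?thesis by simp
qed

lemma valency_lines:
  assumes x: "x \<in> V"
  shows "b 0 = (\<Sum>C\<in>lines_at x. card C - 1)"
proof -
  have "b 0 = (\<Sum>y\<in>nb x. 1)" using card_nb[OF x] by simp
  also have "\<dots> = (\<Sum>C\<in>lines_at x. card C - 1)"
    unfolding sum_nb_lines[of "\<lambda>_. 1 :: nat"] using line_clique clique_fin
    by (intro sum.cong) (auto simp: lines_at_def)
  finally show ?thesis .
qed

text \<open>A line through \<open>x\<close> contributes between \<open>lam + 1 - s * M\<close> and
  \<open>lam + 1\<close> neighbours. The defect is at most half of \<open>lam + 1\<close>, so
  \<open>valency_le\<close> loses only a factor two in the last bound.\<close>

lemma lines_at_bounds:
  assumes x: "x \<in> V"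
  shows "b 0 \<le> card (lines_at x) * (lam + 1)"
    and "card (lines_at x) * (lam + 1) \<le> b 0 + card (lines_at x) * (s * M)"
    and "card (lines_at x) \<le> 2 * s"
proof -
  have l: "lam + 1 \<le> (card C - 1) + s * M" "card C - 1 \<le> lam + 1" if "C \<in> lines_at x" for C
    using line_card[of C] that unfolding lines_at_def by auto
  have "b 0 \<le> (\<Sum>C\<in>lines_at x. lam + 1)"
    unfolding valency_lines[OF x] using l by (intro sum_mono)
  then show "b 0 \<le> card (lines_at x) * (lam + 1)" by simp
  have "(\<Sum>C\<in>lines_at x. lam + 1) \<le> (\<Sum>C\<in>lines_at x. (card C - 1) + s * M)"
    using l by (intro sum_mono)
  then show 2: "card (lines_at x) * (lam + 1) \<le> b 0 + card (lines_at x) * (s * M)"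
    unfolding valency_lines[OF x] by (simp add: sum.distrib)
  have "card (lines_at x) * (2 * (s * M)) \<le> card (lines_at x) * (lam + 1)"
    using lam_bounds(5) by (intro mult_le_mono2) linarith
  then have "card (lines_at x) * (lam + 1) \<le> 2 * b 0" using 2 by simp
  also have "\<dots> \<le> 2 * s * (lam + 1)" using valency_le[OF x] by (simp add: s_def)
  finally show "card (lines_at x) \<le> 2 * s" by (rule mult_right_le_imp_le) simp
qed

text \<open>An extra line through \<open>y\<close> adds at least \<open>p\<close> to the valency,
  more than the defects of the at most \<open>2 * s\<close> lines at \<open>x\<close> can
  balance.\<close>

lemma card_lines_at_le:
  assumes "x \<in> V" "y \<in> V"
  shows "card (lines_at y) \<le> card (lines_at x)"
proof (rule ccontr)
  assume "\<not> ?thesis"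
  then have le: "card (lines_at x) + 1 \<le> card (lines_at y)" by simp
  define p where "p = lam + 1 - s * M"
  have p: "lam + 1 = p + s * M" using lam_bounds(5) unfolding p_def by simp
  have "card (lines_at y) * p \<le> b 0"
    using lines_at_bounds(2)[OF assms(2)] unfolding p by (simp add: algebra_simps)
  then have "(card (lines_at x) + 1) * p \<le> b 0" using mult_le_mono1[OF le, of p] by linarith
  also have "\<dots> \<le> card (lines_at x) * p + card (lines_at x) * (s * M)"
    using lines_at_bounds(1)[OF assms(1)] unfolding p by (simp add: algebra_simps)
  finally have "p \<le> card (lines_at x) * (s * M)" by simp
  also have "\<dots> \<le> 2 * s * (s * M)" using lines_at_bounds(3)[OF assms(1)] by (rule mult_le_mono1)
  finally have "lam + 1 \<le> s * M * (2 * s + 1)" unfolding p by (simp add: algebra_simps)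
  then show False using lam_bounds(3) by simp
qed

lemma geometric:
  assumes edge: "E x0 y0" and nc: "distance_regular V E" "\<not> complete_graph V E"
    and val: "valency V E = b 0"
  shows "geometric V E"
proof -
  have x0: "x0 \<in> V" using edge E_in by blast
  define \<tau> where "\<tau> = card (lines_at x0)"
  have tau: "card (lines_at x) = \<tau>" if "x \<in> V" for x
    using card_lines_at_le[OF x0 that] card_lines_at_le[OF that x0] by (simp add: \<tau>_def)
  have "lines_at x0 \<noteq> {}" using line_cover[OF edge] unfolding lines_at_def by blast
  then have tau0: "0 < \<tau>" by (simp add: \<tau>_def card_gt_0_iff)
  have double: "(\<Sum>x\<in>V. \<Sum>C\<in>lines_at x. h x C) = (\<Sum>C\<in>lines. \<Sum>x\<in>C. h x C)"
    for h :: "'a \<Rightarrow> 'a set \<Rightarrow> real"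
  proof -
    have "(\<Sum>x\<in>V. \<Sum>C\<in>lines_at x. h x C) = (\<Sum>x\<in>V. \<Sum>C\<in>lines. if x \<in> C then h x C else 0)"
      unfolding lines_at_def by (simp add: sum.inter_filter)
    also have "\<dots> = (\<Sum>C\<in>lines. \<Sum>x\<in>V. if x \<in> C then h x C else 0)" by (rule sum.swap)
    also have "\<dots> = (\<Sum>C\<in>lines. \<Sum>x\<in>C. h x C)"
      using line_clique clique_sub by (intro sum.cong sum.mono_neutral_cong_right) auto
    finally show ?thesis .
  qed
  \<comment> \<open>Lines have more than \<tau> vertices, while a vertex lies on \<tau>
    lines.\<close>
  have few: "card lines < card V"
  proof -
    have "real \<tau> * card V = (\<Sum>x\<in>V. \<Sum>C\<in>lines_at x. 1)" using tau by simp
    also have "\<dots> = (\<Sum>C\<in>lines. real (card C))" unfolding double by simp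
    also have "\<dots> \<ge> (\<Sum>C\<in>lines. real (\<tau> + 1))"
    proof (rule sum_mono)
      fix C assume C: "C \<in> lines"
      have "\<tau> + 1 \<le> card C"
        using line_card(1)[OF C] lines_at_bounds(3)[OF x0] lam_bounds(4) unfolding \<tau>_def by linarith
      then show "real (\<tau> + 1) \<le> real (card C)" by simp
    qed
    finally have "real (card lines * (\<tau> + 1)) \<le> real (\<tau> * card V)" by (simp add: algebra_simps)
    then have "card lines * (\<tau> + 1) \<le> \<tau> * card V" by (simp only: of_nat_le_iff)
    moreover have "card V * (\<tau> + 1) \<le> card lines * (\<tau> + 1)" if "card V \<le> card lines"
      using that by (rule mult_le_mono1)
    moreover have "0 < card V" using x0 by (auto simp: card_gt_0_iff)
    ultimately show ?thesis by (fastforce simp: algebra_simps not_less)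
  qed
  \<comment> \<open>With the vertex-line incidence matrix \<open>N\<close> this is
    \<open>A = N N^T - \<tau> I\<close>: the vertex \<open>x\<close> is counted once on each of its
    \<tau> lines.\<close>
  have op: "adj_op g x = (\<Sum>C\<in>lines_at x. \<Sum>y\<in>C. g y) - \<tau> * g x"
    if "x \<in> V" for g :: "'a \<Rightarrow> real" and x
  proof -
    have "adj_op g x = (\<Sum>C\<in>lines_at x. (\<Sum>y\<in>C. g y) - g x)"
      unfolding adj_op_def sum_nb_lines
    proof (rule sum.cong)
      fix C assume "C \<in> lines_at x"
      then have "finite C" "x \<in> C" using line_clique clique_fin unfolding lines_at_def by auto
      then show "(\<Sum>y\<in>C - {x}. g y) = (\<Sum>y\<in>C. g y) - g x" by (simp add: sum_diff1)
    qed simp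
    then show ?thesis using tau[OF that] by (simp add: sum_subtractf)
  qed
  have lower: "- real \<tau> * ip g g \<le> quad g" for g
  proof -
    have "quad g = (\<Sum>x\<in>V. (\<Sum>C\<in>lines_at x. g x * (\<Sum>y\<in>C. g y)) - \<tau> * (g x * g x))"
      unfolding ip_def
    proof (rule sum.cong)
      fix x assume "x \<in> V"
      then show "g x * adj_op g x = (\<Sum>C\<in>lines_at x. g x * (\<Sum>y\<in>C. g y)) - \<tau> * (g x * g x)"
        by (simp add: op right_diff_distrib flip: sum_distrib_left)
    qed simp
    also have "\<dots> = (\<Sum>C\<in>lines. \<Sum>x\<in>C. g x * (\<Sum>y\<in>C. g y)) - \<tau> * ip g g"
      unfolding ip_def sum_subtractf double by (simp add: sum_distrib_left)
    also have "(\<Sum>C\<in>lines. \<Sum>x\<in>C. g x * (\<Sum>y\<in>C. g y)) = (\<Sum>C\<in>lines. (\<Sum>y\<in>C. g y)\<^sup>2)"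
      by (simp add: sum_distrib_right[symmetric] power2_eq_square)
    finally have "quad g = (\<Sum>C\<in>lines. (\<Sum>y\<in>C. g y)\<^sup>2) - \<tau> * ip g g" .
    moreover have "0 \<le> (\<Sum>C\<in>lines. (\<Sum>y\<in>C. g y)\<^sup>2)" by (intro sum_nonneg) simp
    ultimately show ?thesis by simp
  qed
  \<comment> \<open>Fewer lines than vertices: some nonzero \<open>f\<close> sums to zero on every
    line, so it is an eigenvector for \<open>- \<tau>\<close>.\<close>
  from homogeneous_system[OF finite_lines finV few, of "\<lambda>C x. of_bool (x \<in> C)"]
  obtain f :: "'a \<Rightarrow> real" where
    "(\<exists>x\<in>V. f x \<noteq> 0) \<and> (\<forall>C\<in>lines. (\<Sum>x\<in>V. of_bool (x \<in> C) * f x) = 0)" by (rule exE)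
  then have f: "\<exists>x\<in>V. f x \<noteq> 0" "\<forall>C\<in>lines. (\<Sum>x\<in>V. of_bool (x \<in> C) * f x) = 0"
    by simp_all
  have fC: "(\<Sum>x\<in>C. f x) = 0" if "C \<in> lines" for C
    using f(2) that sum_indicator[OF clique_sub[OF line_clique[OF that]], of f] by simp
  have "adj_op f x = - real \<tau> * f x" if "x \<in> V" for x
    unfolding op[OF that] using fC by (simp add: lines_at_def)
  then have ev: "adj_eigenvalue V E (- real \<tau>)" using f(1) adj_eigenvalue_iff by blast
  have sm: "smallest_eigenvalue V E = - real \<tau>"
  proof (rule antisym)
    show "smallest_eigenvalue V E \<le> - real \<tau>" using smallest_eigenvalue_props(3)[OF ev] .
    obtain g x where g: "x \<in> V" "g x \<noteq> 0" "\<forall>x\<in>V. adj_op g x = smallest_eigenvalue V E * g x"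
      using smallest_eigenvalue_props(1) adj_eigenvalue_iff by blast
    have "- real \<tau> * ip g g \<le> smallest_eigenvalue V E * ip g g"
      using lower[of g] ip_eigenvector[OF g(3)] by simp
    then show "- real \<tau> \<le> smallest_eigenvalue V E"
      by (rule mult_right_le_imp_le) (rule ip_pos[of x g, OF g(1,2)])
  qed
  have le: "(card C - 1) * \<tau> \<le> b 0" if C: "C \<in> lines" for C
  proof -
    have "card C = (card C - 1) + 1" "0 < card C - 1" using line_card(2)[OF C] by auto
    from clique_bound[OF line_clique[OF C] this ev] have "real ((card C - 1) * \<tau>) \<le> real (b 0)" by simp
    then show ?thesis by (simp only: of_nat_le_iff)
  qed
  \<comment> \<open>Delsarte's bound caps each \<open>card C - 1\<close> at
    \<open>b 0 / \<tau>\<close>, and over the \<tau> lines at a vertex these numbers add up to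
    \<open>b 0\<close>; so every cap is attained.\<close>
  have eq: "(card C - 1) * \<tau> = b 0" if C: "C \<in> lines" for C
  proof (rule ccontr)
    assume "(card C - 1) * \<tau> \<noteq> b 0"
    then have lt: "(card C - 1) * \<tau> < b 0" using le[OF C] by simp
    obtain x where x: "x \<in> C" using line_card(2)[OF C] by fastforce
    have xV: "x \<in> V" using x C line_clique clique_sub by blast
    have "(\<Sum>D\<in>lines_at x. (card D - 1) * \<tau>) < (\<Sum>D\<in>lines_at x. b 0)"
      using le lt C x by (intro sum_strict_mono_ex1) (auto simp: lines_at_def)
    then show False
      using valency_lines[OF xV] tau[OF xV] by (simp add: sum_distrib_left mult.commute)
  qed
  have "delsarte_clique V E C" if C: "C \<in> lines" for C
  proof -
    have "real (b 0) = (real (card C) - 1) * real \<tau>"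
      using eq[OF C] line_card(2)[OF C] by (metis of_nat_1 of_nat_diff of_nat_mult one_le_numeral order_trans)
    then have "real (card C) = 1 + real (b 0) / real \<tau>" using tau0 by simp
    then show ?thesis unfolding delsarte_clique_def using line_clique[OF C] sm val by simp
  qed
  moreover have "\<exists>!C. C \<in> lines \<and> x \<in> C \<and> y \<in> C" if "E x y" for x y
    using line_cover[OF that] line_unique that E_irr by metis
  ultimately show ?thesis unfolding geometric_def using nc by blast
qed

end

section \<open>Finiteness\<close>

lemma ex_order_bound:
  fixes m :: nat
  assumes m: "2 \<le> m"
  shows "\<exists>N. \<forall>(V :: 'a set) E. distance_regular V E \<and> \<not> complete_graph V E \<and> coconnected V E
        \<and> \<not> geometric V E \<and> smallest_eigenvalue V E \<ge> - real m
        \<and> intersection_c V E 2 \<ge> 2 \<longrightarrow> card V \<le> N"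
proof -
  define s t where "s = m * m" and "t = 2 * m * m"
  define n0 where "n0 = 8 * s * t + t * (t + s + 4)"
  obtain R0 where R0: "\<And>E :: 'a \<Rightarrow> 'a \<Rightarrow> bool. symp E \<Longrightarrow> ramsey_bound E n0 (s + 1) R0"
    using ex_ramsey_bound by metis
  obtain R1 where R1: "\<And>E :: 'a \<Rightarrow> 'a \<Rightarrow> bool. symp E \<Longrightarrow> ramsey_bound E t (s + 1) R1"
    using ex_ramsey_bound by metis
  \<comment> \<open>The first entry is what \<open>few_nonneighbours\<close> needs, the second what
    \<open>line_drg\<close> needs with \<open>M = R0\<close>.\<close>
  define L where "L = max (4 * (t + 1) * R1 + 1) (4 * (m * m) * (m * m) * (R0 + 1))"
  define k where "k = m * m * (L + 1)"
  define N where "N = max (1 + R1 + R1 * R1) ((k + 1) ^ (2 ^ (2 * k + 2)))"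
  have "card V \<le> N" if a: "distance_regular V E" "\<not> complete_graph V E" "coconnected V E"
    "\<not> geometric V E" "smallest_eigenvalue V E \<ge> - real m" "intersection_c V E 2 \<ge> 2"
    for V :: "'a set" and E
  proof -
    have gm: "graph_metric V E" using a(1) unfolding distance_regular_def by unfold_locales auto
    then interpret graph_metric V E .
    have "\<exists>b c. \<forall>x\<in>V. \<forall>y\<in>V.
        card {z\<in>V. E y z \<and> gdist E x z + 1 = gdist E x y} = c (gdist E x y) \<and>
        card {z\<in>V. E y z \<and> gdist E x z = gdist E x y + 1} = b (gdist E x y)"
      using a(1) unfolding distance_regular_def by (elim conjE)
    then obtain b c where bc: "\<forall>x\<in>V. \<forall>y\<in>V.
        card {z\<in>V. E y z \<and> gdist E x z + 1 = gdist E x y} = c (gdist E x y) \<and>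
        card {z\<in>V. E y z \<and> gdist E x z = gdist E x y + 1} = b (gdist E x y)"
      by (elim exE)
    have restr: "{z\<in>V. E y z \<and> P z} = {z. E y z \<and> P z}" for y P using E_in by blast
    interpret psd_drg V E b c m
    proof
      show "2 \<le> m" by (rule m)
      show "0 \<le> quad f + real m * ip f f" for f
      proof -
        have "- real m * ip f f \<le> smallest_eigenvalue V E * ip f f"
          using a(5) ip_nonneg by (rule mult_right_mono)
        then show ?thesis using smallest_eigenvalue_props(2)[of f] by simp
      qed
    qed (use bc in \<open>simp_all only: restr\<close>)
    obtain x y where xy: "x \<in> V" "y \<in> V" "x \<noteq> y" "\<not> E x y"
      using a(2) unfolding complete_graph_def by blast
    then have "2 \<le> d x y" using d_zero[of x y] d_one[of x y] by (cases "d x y" rule: nat.exhaust) (auto simp: Suc_le_eq intro: Suc_lessI)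
    then obtain z where z: "z \<in> V" "d x z = 2" using d_between[OF xy(1,2)] by blast
    have val: "valency V E = b 0"
    proof -
      have "card {y\<in>V. E x y} = b 0" if "x \<in> V" for x
        using card_nb[OF that] restr[of x "\<lambda>_. True"] by simp
      then show ?thesis unfolding valency_def using xy(1) by (intro the_equality) auto
    qed
    have "intersection_c V E 2 = c 2"
    proof -
      have eq: "card {w\<in>V. E v w \<and> d u w + 1 = 2} = c 2" if "u \<in> V" "v \<in> V" "d u v = 2" for u v
        using card_c[OF that(1,2)] unfolding that(3) restr .
      show ?thesis unfolding intersection_c_def
        by (rule the_equality) (use eq xy(1) z in blast)+
    qed
    then have c2: "2 \<le> c 2" using a(6) by simp
    have sy: "symp E" using E_sym by (auto intro: sympI)
    show ?thesis
    proof (cases "L \<le> lam")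
      case False
      have "b 0 \<le> m * m * (lam + 1)" by (rule valency_le[OF xy(1)])
      also have "\<dots> \<le> k" unfolding k_def using False by (intro mult_le_mono) auto
      finally have bk: "b 0 \<le> k" .
      have "card V \<le> (b 0 + 1) ^ (2 ^ (2 * b 0 + 2))" by (rule card_V_bound[OF c2])
      also have "\<dots> \<le> (k + 1) ^ (2 ^ (2 * b 0 + 2))" using bk by (intro power_mono) auto
      also have "\<dots> \<le> (k + 1) ^ (2 ^ (2 * k + 2))" using bk by (intro power_increasing) auto
      finally show ?thesis by (simp add: N_def)
    next
      case True
      show ?thesis
      proof (cases "R0 \<le> c 2")
        case R: True
        have "\<forall>v\<in>V. card (V - nb v - {v}) \<le> R1"
          by (rule few_nonneighbours[OF _ _ _ R _ xy(1) z])
            (use True R0[OF sy] R1[OF sy] in \<open>simp_all add: n0_def s_def t_def L_def\<close>)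
        then have "card V \<le> 1 + R1 + R1 * R1" using card_le_of_few_nonneighbours[OF a(3)] by blast
        then show ?thesis by (simp add: N_def)
      next
        case R: False
        interpret line_drg V E b c m R0
          by unfold_locales (use R True in \<open>auto simp: L_def\<close>)
        obtain w where "E w z" using d_pred[OF xy(1) z(1), of 1] z(2) by auto
        from geometric[OF this a(1,2) val] show ?thesis using a(4) by blast
      qed
    qed
  qed
  then show ?thesis by blast
qed

text \<open>\<open>F\<close> has to vanish outside the initial segment, so that only finitely many
  relations represent graphs of bounded order.\<close>

lemma iso_nat_graph:
  assumes "finite V"
  shows "\<exists>F. (\<forall>i j. F i j \<longrightarrow> i < card V \<and> j < card V) \<and> graph_iso V E {..<card V} F"
proof -
  obtain f where f: "bij_betw f V {..<card V}"
    using ex_bij_betw_finite_nat[OF assms] by (auto simp: atLeast0LessThan)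
  define F where "F i j \<longleftrightarrow> (\<exists>x\<in>V. \<exists>y\<in>V. i = f x \<and> j = f y \<and> E x y)" for i j
  have "E x y \<longleftrightarrow> F (f x) (f y)" if "x \<in> V" "y \<in> V" for x y
    unfolding F_def using that bij_betw_imp_inj_on[OF f] by (metis inj_onD)
  moreover have "F i j \<longrightarrow> i < card V \<and> j < card V" for i j
    unfolding F_def using f by (auto simp: bij_betw_def)
  ultimately show ?thesis using f unfolding graph_iso_def by (intro exI[of _ F]) blast
qed

lemma finite_nat_graphs: "finite {F :: nat \<Rightarrow> nat \<Rightarrow> bool. \<forall>i j. F i j \<longrightarrow> i < N \<and> j < N}"
proof (rule finite_subset)
  show "{F :: nat \<Rightarrow> nat \<Rightarrow> bool. \<forall>i j. F i j \<longrightarrow> i < N \<and> j < N}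
      \<subseteq> (\<lambda>A i j. (i, j) \<in> A) ` Pow ({..<N} \<times> {..<N})"
  proof
    fix F :: "nat \<Rightarrow> nat \<Rightarrow> bool"
    assume F: "F \<in> {F. \<forall>i j. F i j \<longrightarrow> i < N \<and> j < N}"
    have "F = (\<lambda>i j. (i, j) \<in> {(i, j). F i j})" by simp
    moreover have "{(i, j). F i j} \<in> Pow ({..<N} \<times> {..<N})" using F by auto
    ultimately show "F \<in> (\<lambda>A i j. (i, j) \<in> A) ` Pow ({..<N} \<times> {..<N})" by blast
  qed
qed simp

theorem theorem1p3:
  fixes m :: nat
  assumes "m \<ge> 2"
  shows "\<exists>S :: (nat set \<times> (nat \<Rightarrow> nat \<Rightarrow> bool)) set. finite S \<and>
    (\<forall>(V :: 'a set) E. distance_regular V E \<and> \<not> complete_graph V E \<and> coconnected V E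
        \<and> \<not> geometric V E \<and> smallest_eigenvalue V E \<ge> - real m
        \<and> intersection_c V E 2 \<ge> 2
      \<longrightarrow> (\<exists>(W, F)\<in>S. graph_iso V E W F))"
proof -
  obtain N where N: "\<And>(V :: 'a set) E. distance_regular V E \<and> \<not> complete_graph V E \<and> coconnected V E
        \<and> \<not> geometric V E \<and> smallest_eigenvalue V E \<ge> - real m
        \<and> intersection_c V E 2 \<ge> 2 \<Longrightarrow> card V \<le> N"
    using ex_order_bound[OF assms] by metis
  \<comment> \<open>The relations are confined to numbers below \<open>N\<close>, not to the vertex
    set they are paired with; the set is larger than necessary but still finite.\<close>
  define S where "S = (\<lambda>n. {..<n}) ` {..N} \<times> {F :: nat \<Rightarrow> nat \<Rightarrow> bool. \<forall>i j. F i j \<longrightarrow> i < N \<and> j < N}"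
  have "finite S" unfolding S_def using finite_nat_graphs by blast
  moreover have "\<exists>(W, F)\<in>S. graph_iso V E W F"
    if a: "distance_regular V E \<and> \<not> complete_graph V E \<and> coconnected V E
        \<and> \<not> geometric V E \<and> smallest_eigenvalue V E \<ge> - real m
        \<and> intersection_c V E 2 \<ge> 2" for V :: "'a set" and E
  proof -
    have "finite V" using a unfolding distance_regular_def simple_graph_def by blast
    then obtain F where F: "\<forall>i j. F i j \<longrightarrow> i < card V \<and> j < card V" "graph_iso V E {..<card V} F"
      using iso_nat_graph by blast
    have "card V \<le> N" by (rule N[OF a])
    then have "({..<card V}, F) \<in> S" unfolding S_def using F(1) by (auto intro: less_le_trans)
    then show ?thesis using F(2) by blast
  qed
  ultimately show ?thesis by blast
qed

end
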